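(* Let $g$ be a Gårding-Dirichlet polynomial of degree $N\ge1$ on $S(n)$ with Gårding cone $\Gamma$ and polarization $\overline g$. For all $A,B\in S(n)$, $$g(A)-g(B)=\langle\mathbb{M}(A,B),A-B\rangle\qquad\text{with}\qquad\mathbb{M}(A,B)=\sum_{k=0}^{N-1}\mathbf{M}_k(A,B).$$ Moreover, if $(g,\Gamma)$ is complete, then $$\mathbb{M}(A,B)>0\quad\text{for all }A,B\in\Gamma .$$ In fact (again if $(g,\Gamma)$ is complete), $$\mathbf{M}(G_1,\dots,G_{N-1})>0\quad\text{for all }G_1,\dots,G_{N-1}\in\Gamma .$$
   Context: $S(n)$ is the space of real symmetric $n\times n$ matrices with inner product $\langle A,B\rangle=\mathrm{tr}(AB)$; $M>0$ means positive definite. A Gårding-Dirichlet polynomial (operator) of degree $N$ is a homogeneous real polynomial $g$ of degree $N$ on $S(n)$ such that $g(I)>0$, $t\mapsto g(tI+A)$ has all real roots for every $A\in S(n)$, and the Gårding cone $\Gamma$, i.e. the connected component of $\{g\ne0\}$ containing $I$ (an open convex cone), satisfies $\{A\ge0\}\subset\overline\Gamma$. The same definition applies with $\mathbb{R}^n$ replaced by any finite-dimensional inner product space $V$ and $S(n)$ by the space $\mathrm{Sym}^2(V)$ of quadratic forms on $V$. The pair $(g,\Gamma)$ is complete if there is no proper linear subspace $V\subset\mathbb{R}^n$ and Gårding-Dirichlet polynomial $h$ on $\mathrm{Sym}^2(V)$ with $g(A)=h(A|_V)$ for all $A\in S(n)$, where $A|_V$ is the restriction of the quadratic form $A$ to $V$.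 The polarization $\overline g(A_1,\dots,A_N)$ is the symmetric $N$-linear form on $S(n)$ with $\overline g(A,\dots,A)=g(A)$. For $G_1,\dots,G_{N-1}\in S(n)$, the matrix $\mathbf{M}(G_1,\dots,G_{N-1})\in S(n)$ is defined by $\langle\mathbf{M}(G_1,\dots,G_{N-1}),A\rangle=\overline g(G_1,\dots,G_{N-1},A)$ for all $A\in S(n)$. For $0\le k\le N-1$, $\mathbf{M}_k(A,B)=\mathbf{M}(A,\dots,A,B,\dots,B)$ with $k$ entries $A$ and $N-1-k$ entries $B$. *)

theory Defs
  imports "HOL-Analysis.Analysis" "HOL-Computational_Algebra.Computational_Algebra"
begin

definition sym_mats :: "(real^'n^'n) set" where
  "sym_mats = {A. transpose A = A}"

definition mat_inner :: "real^'n^'n \<Rightarrow> real^'n^'n \<Rightarrow> real" where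
  "mat_inner A B = trace (A ** B)"

definition qform :: "real^'n^'n \<Rightarrow> real^'n \<Rightarrow> real" where
  "qform A v = v \<bullet> (A *v v)"

definition pos_def :: "real^'n^'n \<Rightarrow> bool" where
  "pos_def A \<longleftrightarrow> A \<in> sym_mats \<and> (\<forall>v. v \<noteq> 0 \<longrightarrow> qform A v > 0)"

text \<open>
  Quadratic forms on a linear subspace \<open>V\<close> of \<open>\<real>\<^sup>n\<close>. Just as a quadratic form on \<open>\<real>\<^sup>n\<close> is
  identified with a symmetric matrix by means of the inner product, a quadratic form on \<open>V\<close> is
  identified with the symmetric endomorphism of \<open>V\<close> representing it; the latter is stored as the
  symmetric matrix which agrees with it on \<open>V\<close> and vanishes on the orthogonal complement of \<open>V\<close>,
  i.e. as a symmetric matrix with range in \<open>V\<close>. The form attached to \<open>B \<in> Sym2 V\<close> is \<open>qform B\<close>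
  on \<open>V\<close>. Lemma \<open>ex1_restrict_form\<close> below shows that each quadratic form on \<open>V\<close>
  (they all extend to \<open>\<real>\<^sup>n\<close>) is represented by exactly one element of \<open>Sym2 V\<close>.
\<close>

definition Sym2 :: "(real^'n) set \<Rightarrow> (real^'n^'n) set" where
  "Sym2 V = {A \<in> sym_mats. \<forall>x. A *v x \<in> V}"

definition restrict_form :: "(real^'n) set \<Rightarrow> real^'n^'n \<Rightarrow> real^'n^'n" where
  "restrict_form V A = (THE B. B \<in> Sym2 V \<and> (\<forall>v\<in>V. qform B v = qform A v))"

lemma Sym2_UNIV: "Sym2 UNIV = sym_mats"
  by (simp add: Sym2_def)

lemma sym_mats_inner:
  assumes "A \<in> sym_mats"
  shows "x \<bullet> (A *v y) = (A *v x) \<bullet> y"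
  using assms by (metis (mono_tags) mem_Collect_eq sym_mats_def dot_lmul_matrix vector_transpose_matrix)

lemma ex1_restrict_form:
  fixes A :: "real^'n^'n" and V :: "(real^'n) set"
  assumes A: "A \<in> sym_mats" and V: "subspace V"
  shows "\<exists>!B. B \<in> Sym2 V \<and> (\<forall>v\<in>V. qform B v = qform A v)"
proof -
  have "\<exists>y. y \<in> V \<and> (\<forall>w\<in>V. (x - y) \<bullet> w = 0)" for x
  proof -
    obtain y z where "y \<in> span V" "\<And>w. w \<in> span V \<Longrightarrow> orthogonal z w" "x = y + z"
      using orthogonal_subspace_decomp_exists [of V x] by blast
    then show ?thesis
      using V by (intro exI[of _ y]) (auto simp: orthogonal_def span_eq_iff[THEN iffD2])
  qed
  then obtain P where PV: "\<And>x. P x \<in> V" and Porth: "\<And>x w. w \<in> V \<Longrightarrow> (x - P x) \<bullet> w = 0"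
    by metis
  have uniqP: "y = P x" if "y \<in> V" "\<And>w. w \<in> V \<Longrightarrow> (x - y) \<bullet> w = 0" for x y
  proof -
    have "y - P x \<in> V"
      using that PV V by (simp add: subspace_diff)
    then have "(x - P x) \<bullet> (y - P x) = 0" "(x - y) \<bullet> (y - P x) = 0"
      using that Porth by auto
    then have "(y - P x) \<bullet> (y - P x) = 0"
      by (simp add: inner_diff_left)
    then show ?thesis by simp
  qed
  have lin: "linear P"
  proof (rule linearI)
    fix x y show "P (x + y) = P x + P y"
    proof (rule uniqP[symmetric])
      show "P x + P y \<in> V" using PV V by (simp add: subspace_add)
      show "(x + y - (P x + P y)) \<bullet> w = 0" if "w \<in> V" for w
        using Porth[OF that, of x] Porth[OF that, of y]
        by (simp add: inner_diff_left inner_add_left)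
    qed
  next
    fix c x show "P (c *\<^sub>R x) = c *\<^sub>R P x"
    proof (rule uniqP[symmetric])
      show "c *\<^sub>R P x \<in> V" using PV V by (simp add: subspace_scale)
      show "(c *\<^sub>R x - c *\<^sub>R P x) \<bullet> w = 0" if "w \<in> V" for w
        using Porth[OF that, of x] by (simp add: inner_diff_left)
    qed
  qed
  have Pid: "P v = v" if "v \<in> V" for v
    using uniqP[OF that, of v] by simp
  have Psa: "x \<bullet> P y = P x \<bullet> y" for x y
    using Porth[OF PV, of x y] Porth[OF PV, of y x]
    by (simp add: inner_diff_left inner_diff_right inner_commute)
  define Q where "Q = matrix P"
  have Q: "Q *v x = P x" for x
    using lin by (simp add: Q_def matrix_works)
  have "transpose Q = Q"
  proof -
    have "adjoint P = P"
      by (rule adjoint_unique) (simp add: Psa)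
    then show ?thesis
      using matrix_adjoint[OF lin] by (simp add: Q_def)
  qed
  define B where "B = Q ** A ** Q"
  have B: "B *v x = P (A *v P x)" for x
    by (simp add: B_def Q matrix_vector_mul_assoc[symmetric])
  have "transpose B = B"
    using \<open>transpose Q = Q\<close> A
    by (simp add: B_def matrix_transpose_mul sym_mats_def matrix_mul_assoc)
  then have B1: "B \<in> Sym2 V"
    by (simp add: Sym2_def sym_mats_def B PV)
  have B2: "qform B v = qform A v" if "v \<in> V" for v
    by (simp add: qform_def B Psa Pid that)
  show ?thesis
  proof (rule ex1I[of _ B])
    show "B \<in> Sym2 V \<and> (\<forall>v\<in>V. qform B v = qform A v)" using B1 B2 by blast
  next
    fix C assume C: "C \<in> Sym2 V \<and> (\<forall>v\<in>V. qform C v = qform A v)"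
    define D where "D = C - B"
    have Dv: "D *v x = C *v x - B *v x" for x
      by (simp add: D_def matrix_vector_mult_diff_rdistrib)
    have DV: "D *v x \<in> V" for x
      using C B1 V by (simp add: Dv Sym2_def subspace_diff)
    have Dsym: "x \<bullet> (D *v y) = (D *v x) \<bullet> y" for x y
      using C B1 sym_mats_inner[of C x y] sym_mats_inner[of B x y]
      by (simp add: Dv Sym2_def inner_diff_left inner_diff_right)
    have Dq: "v \<bullet> (D *v v) = 0" if "v \<in> V" for v
      using C B2 that by (simp add: Dv qform_def inner_diff_right)
    have Dbil: "u \<bullet> (D *v v) = 0" if "u \<in> V" "v \<in> V" for u v
    proof -
      have "(u + v) \<bullet> (D *v (u + v)) = 0"
        using that V by (intro Dq) (simp add: subspace_add)
      then have "u \<bullet> (D *v v) + v \<bullet> (D *v u) = 0"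
        using that Dq by (simp add: matrix_vector_right_distrib inner_add_left inner_add_right)
      moreover have "v \<bullet> (D *v u) = u \<bullet> (D *v v)"
        using Dsym[of v u] by (simp add: inner_commute)
      ultimately show ?thesis by simp
    qed
    have "D *v x = 0" for x
    proof -
      have "D *v (D *v x) = 0"
        using Dbil[OF DV DV, of "D *v x" x] by simp
      then have "(D *v x) \<bullet> (D *v x) = 0"
        using Dsym[of "D *v x" x] by simp
      then show ?thesis by simp
    qed
    then have "C *v x = B *v x" for x
      using Dv[of x] by simp
    then show "C = B"
      by (simp add: matrix_eq)
  qed
qed

text \<open>
  The identity \<open>I\<close> of the inner product space \<open>V\<close>, viewed as the quadratic form \<open>v \<mapsto> v \<bullet> v\<close>;
  its matrix is the orthogonal projection onto \<open>V\<close>.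
\<close>

definition id_form :: "(real^'n) set \<Rightarrow> real^'n^'n" where
  "id_form V = restrict_form V (mat 1)"

lemma restrict_form_UNIV: "A \<in> sym_mats \<Longrightarrow> restrict_form UNIV A = A"
  unfolding restrict_form_def
  by (rule the1_equality[OF ex1_restrict_form]) (auto simp: Sym2_UNIV)

lemma id_form_UNIV: "id_form UNIV = mat 1"
  by (simp add: id_form_def restrict_form_UNIV sym_mats_def transpose_mat)

text \<open>
  Functions on \<open>Sym2 V\<close> are total functions on matrices of which only the values on \<open>Sym2 V\<close>
  matter.
\<close>

definition homogeneous_poly_on :: "(real^'n) set \<Rightarrow> nat \<Rightarrow> (real^'n^'n \<Rightarrow> real) \<Rightarrow> bool" where
  "homogeneous_poly_on V N g \<longleftrightarrow>
     (\<exists>p. real_polynomial_function p \<and> (\<forall>A\<in>Sym2 V. g A = p A)) \<and>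
     (\<forall>A\<in>Sym2 V. \<forall>t. g (t *\<^sub>R A) = t ^ N * g A)"

definition all_roots_real :: "(real \<Rightarrow> real) \<Rightarrow> bool" where
  "all_roots_real f \<longleftrightarrow>
     (\<exists>p :: real poly. (\<forall>t. f t = poly p t) \<and>
        (\<forall>z :: complex. poly (map_poly complex_of_real p) z = 0 \<longrightarrow> z \<in> \<real>))"

definition garding_cone :: "(real^'n) set \<Rightarrow> (real^'n^'n \<Rightarrow> real) \<Rightarrow> (real^'n^'n) set" where
  "garding_cone V g = connected_component_set {A \<in> Sym2 V. g A \<noteq> 0} (id_form V)"

definition garding_dirichlet :: "(real^'n) set \<Rightarrow> nat \<Rightarrow> (real^'n^'n \<Rightarrow> real) \<Rightarrow> bool" where
  "garding_dirichlet V N g \<longleftrightarrow>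
     homogeneous_poly_on V N g \<and>
     g (id_form V) > 0 \<and>
     (\<forall>A\<in>Sym2 V. all_roots_real (\<lambda>t. g (t *\<^sub>R id_form V + A))) \<and>
     {A \<in> Sym2 V. \<forall>v\<in>V. qform A v \<ge> 0} \<subseteq> closure (garding_cone V g)"

definition complete_garding :: "(real^'n^'n \<Rightarrow> real) \<Rightarrow> bool" where
  "complete_garding g \<longleftrightarrow>
     \<not> (\<exists>V K h. subspace V \<and> V \<noteq> UNIV \<and> garding_dirichlet V K h \<and>
           (\<forall>A\<in>sym_mats. g A = h (restrict_form V A)))"

definition is_polarization ::
    "nat \<Rightarrow> (real^'n^'n \<Rightarrow> real) \<Rightarrow> ((real^'n^'n) list \<Rightarrow> real) \<Rightarrow> bool" where
  "is_polarization N g G \<longleftrightarrow>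
     (\<forall>As A B s t i. length As = N \<and> set As \<subseteq> sym_mats \<and> A \<in> sym_mats \<and> B \<in> sym_mats \<and> i < N \<longrightarrow>
        G (As[i := s *\<^sub>R A + t *\<^sub>R B]) = s * G (As[i := A]) + t * G (As[i := B])) \<and>
     (\<forall>As Bs. length As = N \<and> set As \<subseteq> sym_mats \<and> mset Bs = mset As \<longrightarrow> G Bs = G As) \<and>
     (\<forall>A\<in>sym_mats. G (replicate N A) = g A)"

text \<open>
  The polarization exists for a homogeneous polynomial of degree \<open>N\<close> and is unique on lists of
  length \<open>N\<close> of symmetric matrices, so the choice only concerns irrelevant arguments.
\<close>

definition polarization :: "nat \<Rightarrow> (real^'n^'n \<Rightarrow> real) \<Rightarrow> (real^'n^'n) list \<Rightarrow> real" where
  "polarization N g = (SOME G. is_polarization N g G)"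

definition polar_mat :: "nat \<Rightarrow> (real^'n^'n \<Rightarrow> real) \<Rightarrow> (real^'n^'n) list \<Rightarrow> real^'n^'n" where
  "polar_mat N g Gs =
     (THE M. M \<in> sym_mats \<and> (\<forall>A\<in>sym_mats. mat_inner M A = polarization N g (Gs @ [A])))"

definition polar_mat_k ::
    "nat \<Rightarrow> (real^'n^'n \<Rightarrow> real) \<Rightarrow> nat \<Rightarrow> real^'n^'n \<Rightarrow> real^'n^'n \<Rightarrow> real^'n^'n" where
  "polar_mat_k N g k A B = polar_mat N g (replicate k A @ replicate (N - 1 - k) B)"

definition polar_mat_sum ::
    "nat \<Rightarrow> (real^'n^'n \<Rightarrow> real) \<Rightarrow> real^'n^'n \<Rightarrow> real^'n^'n \<Rightarrow> real^'n^'n" where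
  "polar_mat_sum N g A B = (\<Sum>k = 0..N - 1. polar_mat_k N g k A B)"

end

theory Submission
  imports Defs
begin

text \<open>
  Telescoping reduces the identity for \<open>g A - g B\<close> to the multilinearity of the polarization, and the
  positivity of the sum to that of each summand. So the content of the theorem is that
  \<open>\<langle>M(G\<^sub>1, \<dots>, G\<^sub>N\<^sub>-\<^sub>1), v v\<^sup>T\<rangle>\<close>, which is the polarization at \<open>G\<^sub>1, \<dots>, G\<^sub>N\<^sub>-\<^sub>1, v v\<^sup>T\<close>, is strictly positive for
  unit vectors \<open>v\<close>.

  \<^emph>\<open>Nonnegativity\<close> is Garding's inequality: the polarization is positive on the cone, hence nonnegative
  on its closure, which contains \<open>v v\<^sup>T\<close>. It is proved here with complex zeros. A homogeneous polynomial
  that is hyperbolic in the direction \<open>e\<close> has no zero \<open>x + iy\<close> with \<open>y\<close> in its cone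
  (\<open>complex_poly_nonzero_on_tube\<close>, \<open>stable_on_cone_at\<close>); a connectedness argument moves the direction
  of hyperbolicity through the cone and also shows that the cone is closed under addition
  (\<open>positive_cone_cone_at\<close>). By Gauss-Lucas, absence of zeros in a tube is inherited by derivatives in
  directions of the cone (\<open>stable_on_insert_arg\<close>). After \<open>N\<close> derivatives a nonzero constant is left,
  the polarization up to a factor, and its sign is preserved in each step (\<open>stable_form_pos\<close>).

  \<^emph>\<open>Strictness\<close> comes from the openness of the cone: a multilinear form that is nonnegative on an open
  cone and vanishes at one point of it vanishes identically (\<open>nonneg_form_eq_zero\<close>). So if the
  polarization vanishes at \<open>G\<^sub>1, \<dots>, G\<^sub>N\<^sub>-\<^sub>1, v v\<^sup>T\<close>, then it vanishes whenever one argument is \<open>v v\<^sup>T\<close>. Positive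
  semidefinite matrices of the form \<open>(large) v v\<^sup>T \<plusminus> D + (small) I\<close> show the same for every symmetric
  \<open>D\<close> whose quadratic form vanishes on the hyperplane orthogonal to \<open>v\<close>. Hence \<open>g\<close> factors through
  restriction to that hyperplane, which completeness forbids (\<open>polar_form_rank_one_pos\<close>).

  The general theory is developed for symmetric multilinear forms on an arbitrary Euclidean space; a
  polynomial on symmetric matrices is fed into it after composition with the symmetrization of matrices.
\<close>

section \<open>Symmetric multilinear forms\<close>

text \<open>
A symmetric \<open>n\<close>-linear form is a function of the \<^emph>\<open>multiset\<close> of its \<open>n\<close> arguments: symmetry is then
automatic, and linearity has to be required in one slot only. The scalar action \<open>s\<close> is a parameter,
so that the same lemmas serve a real vector space and its complexification.
\<close>

definition symmetric_form ::
    "('k::field \<Rightarrow> 'v \<Rightarrow> 'v) \<Rightarrow> nat \<Rightarrow> ('v::ab_group_add multiset \<Rightarrow> 'k) \<Rightarrow> bool" where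
  "symmetric_form s n \<Lambda> \<longleftrightarrow>
     (\<forall>u v c X. Suc (size X) = n \<longrightarrow>
        \<Lambda> (add_mset (u + s c v) X) = \<Lambda> (add_mset u X) + c * \<Lambda> (add_mset v X))"

definition insert_arg :: "'v \<Rightarrow> ('v multiset \<Rightarrow> 'k) \<Rightarrow> 'v multiset \<Rightarrow> 'k" where
  "insert_arg v \<Lambda> X = \<Lambda> (add_mset v X)"

lemma symmetric_formD:
  assumes "symmetric_form s n \<Lambda>" "Suc (size X) = n"
  shows "\<Lambda> (add_mset (u + s c v) X) = \<Lambda> (add_mset u X) + c * \<Lambda> (add_mset v X)"
  using assms by (auto simp: symmetric_form_def)

lemma symmetric_form_insert_arg:
  fixes \<Lambda> :: "'v::ab_group_add multiset \<Rightarrow> 'k::field"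
  assumes "symmetric_form s (Suc n) \<Lambda>"
  shows "symmetric_form s n (insert_arg v \<Lambda>)"
  unfolding symmetric_form_def insert_arg_def
proof (intro allI impI)
  fix u w :: 'v and c and X :: "'v multiset" assume "Suc (size X) = n"
  then show "\<Lambda> (add_mset v (add_mset (u + s c w) X)) =
      \<Lambda> (add_mset v (add_mset u X)) + c * \<Lambda> (add_mset v (add_mset w X))"
    using symmetric_formD[OF assms, of "add_mset v X" u c w]
    by (simp add: add_mset_commute)
qed

lemma symmetric_form_linear:
  fixes \<Lambda> :: "'a::real_vector multiset \<Rightarrow> real"
  assumes "symmetric_form (*\<^sub>R) n \<Lambda>" "Suc (size X) = n"
  shows "linear (\<lambda>x. \<Lambda> (add_mset x X))"
proof -
  have *: "\<Lambda> (add_mset (u + c *\<^sub>R v) X) = \<Lambda> (add_mset u X) + c * \<Lambda> (add_mset v X)" for u c v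
    using symmetric_formD[OF assms] .
  have z: "\<Lambda> (add_mset 0 X) = 0"
    using *[of 0 1 0] by simp
  show ?thesis
    using *[of _ 1] *[of 0] z by (intro linearI) auto
qed

text \<open>
The only part of the binomial expansion of a form on the line \<open>u + z v\<close> that is ever needed: its
top, constant and linear coefficients. Tracking just these three through the induction (splitting
off one argument as \<open>u + z v\<close>) avoids binomial coefficients.
\<close>

lemma symmetric_form_along_line:
  assumes "symmetric_form s n \<Lambda>"
  shows "\<exists>p. degree p \<le> n \<and> (\<forall>z. poly p z = \<Lambda> (replicate_mset n (u + s z v))) \<and>
    coeff p n = \<Lambda> (replicate_mset n v) \<and> coeff p 0 = \<Lambda> (replicate_mset n u) \<and>
    (n \<noteq> 0 \<longrightarrow> coeff p 1 = of_nat n * \<Lambda> (add_mset v (replicate_mset (n - 1) u)))"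
  using assms
proof (induction n arbitrary: \<Lambda>)
  case 0
  show ?case by (rule exI[of _ "[:\<Lambda> {#}:]"]) simp
next
  case (Suc n)
  obtain p where p: "degree p \<le> n" "\<And>z. poly p z = \<Lambda> (add_mset u (replicate_mset n (u + s z v)))"
    "coeff p 0 = \<Lambda> (add_mset u (replicate_mset n u))"
    "n \<noteq> 0 \<Longrightarrow> coeff p 1 = of_nat n * \<Lambda> (add_mset u (add_mset v (replicate_mset (n - 1) u)))"
    using Suc.IH[OF symmetric_form_insert_arg[OF Suc.prems, of u]] by (auto simp: insert_arg_def)
  obtain q where q: "degree q \<le> n" "\<And>z. poly q z = \<Lambda> (add_mset v (replicate_mset n (u + s z v)))"
    "coeff q n = \<Lambda> (add_mset v (replicate_mset n v))"
    "coeff q 0 = \<Lambda> (add_mset v (replicate_mset n u))"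
    using Suc.IH[OF symmetric_form_insert_arg[OF Suc.prems, of v]] by (auto simp: insert_arg_def)
  let ?r = "p + pCons 0 q"
  have "degree ?r \<le> Suc n"
    using p(1) q(1) by (intro degree_add_le) (auto simp: degree_pCons_le le_SucI intro: order_trans[OF degree_pCons_le])
  moreover have "poly ?r z = \<Lambda> (replicate_mset (Suc n) (u + s z v))" for z
    using symmetric_formD[OF Suc.prems, of "replicate_mset n (u + s z v)" u z v] p(2) q(2) by simp
  moreover have "coeff ?r (Suc n) = \<Lambda> (replicate_mset (Suc n) v)"
    using p(1) q(3) by (simp add: coeff_eq_0)
  moreover have "coeff ?r 0 = \<Lambda> (replicate_mset (Suc n) u)"
    using p(3) by simp
  moreover have "coeff ?r 1 = of_nat (Suc n) * \<Lambda> (add_mset v (replicate_mset n u))"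
  proof (cases "n = 0")
    case True
    then show ?thesis using p(1) q(4) by (simp add: coeff_eq_0)
  next
    case False
    then obtain m where m: "n = Suc m" by (cases n) auto
    show ?thesis using p(4) q(4) by (simp add: m add_mset_commute algebra_simps)
  qed
  ultimately show ?case by (intro exI[of _ ?r]) auto
qed

section \<open>Complexification\<close>

text \<open>
The complexification of a real space is modelled by pairs: \<open>(x, y)\<close> stands for \<open>x + iy\<close>, and
\<open>complex_scale\<close> is multiplication by a complex number.
\<close>

definition complex_scale :: "complex \<Rightarrow> 'a::real_vector \<times> 'a \<Rightarrow> 'a \<times> 'a" where
  "complex_scale z w =
     (Re z *\<^sub>R fst w - Im z *\<^sub>R snd w, Im z *\<^sub>R fst w + Re z *\<^sub>R snd w)"

text \<open>
The complex multilinear extension of a form: each argument \<open>x + iy\<close> is split into \<open>x\<close> and \<open>y\<close>, and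
the arguments are processed one at a time by a fold whose state is an operation on forms. The order
of processing is irrelevant because the form itself is symmetric.
\<close>

definition complexify :: "('a multiset \<Rightarrow> real) \<Rightarrow> ('a \<times> 'a) multiset \<Rightarrow> complex" where
  "complexify \<Lambda> W =
     fold_mset (\<lambda>w T \<Lambda>. T (insert_arg (fst w) \<Lambda>) + \<i> * T (insert_arg (snd w) \<Lambda>))
       (\<lambda>\<Lambda>. of_real (\<Lambda> {#})) W \<Lambda>"

lemma complexify_empty [simp]: "complexify \<Lambda> {#} = of_real (\<Lambda> {#})"
  by (simp add: complexify_def)

lemma complexify_add_mset:
  fixes \<Lambda> :: "'a multiset \<Rightarrow> real"
  shows "complexify \<Lambda> (add_mset w W) =
     complexify (insert_arg (fst w) \<Lambda>) W + \<i> * complexify (insert_arg (snd w) \<Lambda>) W"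
proof -
  have swap: "insert_arg a (insert_arg b \<Lambda>) = insert_arg b (insert_arg a \<Lambda>)"
    for a b :: 'a and \<Lambda> :: "'a multiset \<Rightarrow> real"
    by (simp add: fun_eq_iff insert_arg_def add_mset_commute)
  interpret comp_fun_commute
    "\<lambda>w T (\<Lambda> :: 'a multiset \<Rightarrow> real).
      T (insert_arg (fst w) \<Lambda>) + \<i> * T (insert_arg (snd w) \<Lambda>)"
    by unfold_locales (auto simp: fun_eq_iff swap algebra_simps)
  show ?thesis by (simp add: complexify_def)
qed

text \<open>
Three terms are what multiplication of one argument by a complex scalar produces: the real and the
imaginary part of \<open>u + c v\<close> are both of the form \<open>x + r y + s z\<close> with real \<open>r\<close> and \<open>s\<close>.
\<close>

lemma complexify_combination:
  fixes \<Lambda> :: "'a::real_vector multiset \<Rightarrow> real"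
  assumes "\<And>X. size X = size W \<Longrightarrow> \<Lambda> X = a X + r * b X + s * c X"
  shows "complexify \<Lambda> W = complexify a W + of_real r * complexify b W + of_real s * complexify c W"
  using assms
proof (induction W arbitrary: \<Lambda> a b c)
  case empty
  then show ?case by simp
next
  case (add w W)
  have "complexify (insert_arg v \<Lambda>) W = complexify (insert_arg v a) W +
      of_real r * complexify (insert_arg v b) W + of_real s * complexify (insert_arg v c) W" for v
    by (rule add.IH) (use add.prems in \<open>simp add: insert_arg_def\<close>)
  then show ?case
    by (simp add: complexify_add_mset algebra_simps)
qed

lemma symmetric_form_complexify:
  fixes \<Lambda> :: "'a::real_vector multiset \<Rightarrow> real"
  assumes "symmetric_form (*\<^sub>R) n \<Lambda>"
  shows "symmetric_form complex_scale n (complexify \<Lambda>)"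
  unfolding symmetric_form_def
proof (intro allI impI)
  fix u v :: "'a \<times> 'a" and c and W :: "('a \<times> 'a) multiset" assume W: "Suc (size W) = n"
  have *: "complexify (insert_arg (x + a *\<^sub>R y + b *\<^sub>R z) \<Lambda>) W = complexify (insert_arg x \<Lambda>) W +
      of_real a * complexify (insert_arg y \<Lambda>) W + of_real b * complexify (insert_arg z \<Lambda>) W"
    for x y z a b
    by (rule complexify_combination)
      (simp add: insert_arg_def W symmetric_formD[OF assms])
  have 1: "fst (u + complex_scale c v) = fst u + Re c *\<^sub>R fst v + (- Im c) *\<^sub>R snd v"
    and 2: "snd (u + complex_scale c v) = snd u + Im c *\<^sub>R fst v + Re c *\<^sub>R snd v"
    by (simp_all add: complex_scale_def)
  have c: "c = of_real (Re c) + \<i> * of_real (Im c)"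
    by (simp add: complex_eq)
  have i: "\<i> * (\<i> * x) = - x" for x by (simp flip: mult.assoc)
  show "complexify \<Lambda> (add_mset (u + complex_scale c v) W) =
      complexify \<Lambda> (add_mset u W) + c * complexify \<Lambda> (add_mset v W)"
    unfolding complexify_add_mset 1 2 *
    by (subst (5) c) (simp add: algebra_simps i)
qed

lemma complexify_add_real:
  fixes \<Lambda> :: "'a::real_vector multiset \<Rightarrow> real"
  assumes "symmetric_form (*\<^sub>R) n \<Lambda>" "Suc (size W) = n"
  shows "complexify \<Lambda> (add_mset (x, 0) W) = complexify (insert_arg x \<Lambda>) W"
proof -
  have "insert_arg 0 \<Lambda> X = 0" if "size X = size W" for X
    using linear_0[OF symmetric_form_linear[OF assms(1)], of X] assms(2) that
    by (simp add: insert_arg_def)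
  then have "complexify (insert_arg 0 \<Lambda>) W = complexify (\<lambda>_. 0) W + of_real 0 * complexify (\<lambda>_. 0) W
      + of_real (-1) * complexify (\<lambda>_. 0) W"
    by (intro complexify_combination) auto
  then show ?thesis by (simp add: complexify_add_mset)
qed

lemma complexify_real:
  fixes \<Lambda> :: "'a::real_vector multiset \<Rightarrow> real"
  assumes "symmetric_form (*\<^sub>R) n \<Lambda>"
  shows "complexify \<Lambda> (replicate_mset n (x, 0)) = of_real (\<Lambda> (replicate_mset n x))"
  using assms
proof (induction n arbitrary: \<Lambda>)
  case (Suc n)
  then show ?case
    using complexify_add_real[OF Suc.prems, of "replicate_mset n (x,0)" x]
      Suc.IH[OF symmetric_form_insert_arg[OF Suc.prems, of x]]
    by (simp add: insert_arg_def)
qed simp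

abbreviation complex_poly :: "nat \<Rightarrow> ('a multiset \<Rightarrow> real) \<Rightarrow> 'a \<times> 'a \<Rightarrow> complex" where
  "complex_poly n \<Lambda> w \<equiv> complexify \<Lambda> (replicate_mset n w)"

lemma symmetric_form_scale:
  assumes "symmetric_form complex_scale n K" "Suc (size W) = n"
  shows "K (add_mset (complex_scale c v) W) = c * K (add_mset v W)"
proof -
  have "K (add_mset 0 W) = 0"
    using symmetric_formD[OF assms, of 0 1 0] by (simp add: complex_scale_def zero_prod_def)
  then show ?thesis
    using symmetric_formD[OF assms, of 0 c v] by simp
qed

lemma complex_form_homogeneous:
  assumes "symmetric_form complex_scale n K"
  shows "K (replicate_mset n (complex_scale z w)) = z ^ n * K (replicate_mset n w)"
  using assms
proof (induction n arbitrary: K)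
  case (Suc n)
  have "K (add_mset (complex_scale z w) (replicate_mset n (complex_scale z w)))
      = z * K (add_mset w (replicate_mset n (complex_scale z w)))"
    using symmetric_form_scale[OF Suc.prems] by simp
  also have "K (add_mset w (replicate_mset n (complex_scale z w))) = z ^ n * K (add_mset w (replicate_mset n w))"
    using Suc.IH[OF symmetric_form_insert_arg[OF Suc.prems, of w]] by (simp add: insert_arg_def)
  finally show ?case by simp
qed simp

text \<open>
Expanding one argument in a basis writes the value on \<open>n\<close> equal arguments as a finite sum of
coordinates times such values for forms of degree \<open>n - 1\<close>.
\<close>

lemma continuous_complex_form:
  fixes K :: "('a::euclidean_space \<times> 'a) multiset \<Rightarrow> complex"
  assumes "symmetric_form complex_scale n K"
  shows "continuous_on UNIV (\<lambda>w. K (replicate_mset n w))"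
  using assms
proof (induction n arbitrary: K)
  case (Suc n)
  have real: "complex_scale (of_real r) w = r *\<^sub>R w" for r and w :: "'a \<times> 'a"
    by (simp add: complex_scale_def prod_eq_iff)
  have expand: "K (add_mset w W) = (\<Sum>b\<in>Basis. of_real (w \<bullet> b) * K (add_mset b W))"
    if "size W = n" for w W
  proof -
    have scale: "K (add_mset (r *\<^sub>R v) W) = of_real r * K (add_mset v W)" for r v
      using symmetric_form_scale[OF Suc.prems, of W "of_real r" v] that by (simp add: real)
    have "linear (\<lambda>w. K (add_mset w W))"
      using symmetric_formD[OF Suc.prems, of W _ 1] that scale real[of 1]
      by (intro linearI) (auto simp: scaleR_conv_of_real)
    then have "K (add_mset (\<Sum>b\<in>Basis. (w \<bullet> b) *\<^sub>R b) W) = (\<Sum>b\<in>Basis. K (add_mset ((w \<bullet> b) *\<^sub>R b) W))"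
      using linear_sum by blast
    then show ?thesis by (simp add: euclidean_representation scale)
  qed
  have "continuous_on UNIV (\<lambda>w. K (add_mset b (replicate_mset n w)))" for b
    using Suc.IH[OF symmetric_form_insert_arg[OF Suc.prems, of b]] by (simp add: insert_arg_def)
  then have "continuous_on UNIV (\<lambda>w. \<Sum>b\<in>Basis. of_real (w \<bullet> b) * K (add_mset b (replicate_mset n w)))"
    by (intro continuous_intros)
  moreover have "K (replicate_mset (Suc n) w) =
      (\<Sum>b\<in>Basis. of_real (w \<bullet> b) * K (add_mset b (replicate_mset n w)))" for w
    unfolding replicate_mset_Suc by (rule expand) simp
  ultimately show ?case by presburger
qed simp

lemma continuous_complex_poly:
  fixes \<Lambda> :: "'a::euclidean_space multiset \<Rightarrow> real"
  assumes "symmetric_form (*\<^sub>R) n \<Lambda>" "continuous_on S h"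
  shows "continuous_on S (\<lambda>x. complex_poly n \<Lambda> (h x))"
  using continuous_on_compose2[OF continuous_complex_form[OF symmetric_form_complexify[OF assms(1)]] assms(2)]
  by simp

section \<open>Complex polynomials with roots in a half-plane\<close>

lemma complex_poly_factorization:
  fixes p :: "complex poly"
  assumes "p \<noteq> 0"
  shows "\<exists>A. size A = degree p \<and> p = smult (lead_coeff p) (\<Prod>x\<in>#A. [:- x, 1:]) \<and>
    (\<forall>x\<in>#A. poly p x = 0)"
proof -
  obtain A where A: "size A = degree p" "p = smult (lead_coeff p) (\<Prod>x\<in>#A. [:- x, 1:])"
    using alg_closed_imp_factorization[OF assms] by blast
  have "poly p x = 0" if "x \<in># A" for x
  proof -
    have "poly (\<Prod>x\<in>#A. [:- x, 1:]) x = 0"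
      using that by (auto simp: poly_prod_mset prod_mset_zero_iff)
    then show ?thesis by (subst A(2)) simp
  qed
  then show ?thesis using A by blast
qed

text \<open>
A quantitative form of the absence of roots in the upper half-plane. Its point is that it is a
closed condition on the polynomial, so it survives limits in which the degree does not drop; this
takes the place of Hurwitz's theorem.
\<close>

lemma norm_poly_ge_of_roots:
  fixes p :: "complex poly"
  assumes roots: "\<And>r. poly p r = 0 \<Longrightarrow> Im r \<le> 0" and z: "Im z > 0"
  shows "norm (lead_coeff p) * Im z ^ degree p \<le> norm (poly p z)"
proof (cases "p = 0")
  case False
  then obtain A where A: "size A = degree p" "p = smult (lead_coeff p) (\<Prod>x\<in>#A. [:- x, 1:])"
    "\<And>x. x \<in># A \<Longrightarrow> poly p x = 0"
    using complex_poly_factorization by blast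
  have "Im x \<le> 0" if "x \<in># A" for x
    using A(3)[OF that] by (rule roots)
  then have "Im z ^ size A \<le> norm (poly (\<Prod>x\<in>#A. [:- x, 1:]) z)"
  proof (induction A)
    case (add x A)
    have "Im z \<le> norm (z - x)"
      using add.prems[of x] abs_Im_le_cmod[of "z - x"] z by simp
    moreover have "Im z ^ size A \<le> norm (poly (\<Prod>x\<in>#A. [:- x, 1:]) z)"
      using add by auto
    ultimately have "Im z * Im z ^ size A \<le> norm (z - x) * norm (poly (\<Prod>x\<in>#A. [:- x, 1:]) z)"
      using z by (intro mult_mono) auto
    moreover have "poly (\<Prod>x\<in>#add_mset x A. [:- x, 1:]) z = (z - x) * poly (\<Prod>x\<in>#A. [:- x, 1:]) z"
      by (simp add: algebra_simps)
    ultimately show ?case by (simp add: norm_mult)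
  qed simp
  then have "norm (lead_coeff p) * Im z ^ degree p \<le> norm (poly (smult (lead_coeff p) (\<Prod>x\<in>#A. [:- x, 1:])) z)"
    by (simp add: A(1) norm_mult mult_left_mono)
  then show ?thesis using A(2) by simp
qed simp

text \<open>
The special case of the Gauss-Lucas theorem at the point 0. The logarithmic derivative at 0 is
\<open>- (\<Sum>r. 1 / r)\<close> over the roots \<open>r\<close>, and for \<open>Im r < 0\<close> each summand \<open>- 1 / r\<close> lies in the open lower
half-plane.
\<close>

lemma coeff_1_nonzero_of_roots:
  fixes p :: "complex poly"
  assumes roots: "\<And>r. poly p r = 0 \<Longrightarrow> Im r < 0" and d: "degree p \<noteq> 0"
  shows "coeff p 1 \<noteq> 0"
proof -
  have "p \<noteq> 0" using d by auto
  then obtain A where A: "size A = degree p" "p = smult (lead_coeff p) (\<Prod>x\<in>#A. [:- x, 1:])"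
    "\<And>x. x \<in># A \<Longrightarrow> poly p x = 0"
    using complex_poly_factorization by blast
  define P where "P = (\<lambda>A::complex multiset. \<Prod>x\<in>#A. [:- x, 1:])"
  have "Im x < 0" if "x \<in># A" for x
    using A(3)[OF that] by (rule roots)
  then have "coeff (P A) 0 \<noteq> 0 \<and> Im (coeff (P A) 1 / coeff (P A) 0) \<le> 0 \<and>
      (A \<noteq> {#} \<longrightarrow> Im (coeff (P A) 1 / coeff (P A) 0) < 0)"
  proof (induction A)
    case empty
    show ?case by (simp add: P_def)
  next
    case (add x A)
    have x: "Im x < 0" "x \<noteq> 0" using add.prems[of x] by auto
    have 0: "coeff (P (add_mset x A)) 0 = - x * coeff (P A) 0"
      by (simp add: P_def)
    have 1: "coeff (P (add_mset x A)) 1 = - x * coeff (P A) 1 + coeff (P A) 0"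
      by (simp add: P_def)
    have nz: "coeff (P A) 0 \<noteq> 0" and le: "Im (coeff (P A) 1 / coeff (P A) 0) \<le> 0"
      using add by auto
    have "coeff (P (add_mset x A)) 1 / coeff (P (add_mset x A)) 0
        = coeff (P A) 1 / coeff (P A) 0 + (- inverse x)"
      unfolding 0 1 using x nz by (simp add: field_simps)
    moreover have "Im (- inverse x) < 0"
      using x by (auto simp: complex_eq_iff sum_power2_gt_zero_iff divide_neg_pos)
    ultimately show ?case using nz le x 0 by simp
  qed
  moreover have "A \<noteq> {#}" using A(1) d by auto
  ultimately have "coeff (P A) 1 \<noteq> 0" by auto
  then show ?thesis using A(2) \<open>p \<noteq> 0\<close> by (metis P_def coeff_smult leading_coeff_0_iff mult_eq_0_iff)
qed

section \<open>Hyperbolic polynomials and their cones\<close>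

abbreviation diag :: "nat \<Rightarrow> ('a multiset \<Rightarrow> real) \<Rightarrow> 'a \<Rightarrow> real" where
  "diag n \<Lambda> x \<equiv> \<Lambda> (replicate_mset n x)"

lemma complex_poly_scale:
  fixes \<Lambda> :: "'a::real_vector multiset \<Rightarrow> real"
  assumes "symmetric_form (*\<^sub>R) n \<Lambda>"
  shows "complex_poly n \<Lambda> (complex_scale z w) = z ^ n * complex_poly n \<Lambda> w"
  by (rule complex_form_homogeneous[OF symmetric_form_complexify[OF assms]])

lemma complex_poly_scaleR:
  fixes \<Lambda> :: "'a::real_vector multiset \<Rightarrow> real"
  assumes "symmetric_form (*\<^sub>R) n \<Lambda>"
  shows "complex_poly n \<Lambda> (r *\<^sub>R x, r *\<^sub>R y) = of_real r ^ n * complex_poly n \<Lambda> (x, y)"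
  using complex_poly_scale[OF assms, of "of_real r" "(x, y)"] by (simp add: complex_scale_def)

lemma complex_poly_scale_real:
  fixes \<Lambda> :: "'a::real_vector multiset \<Rightarrow> real"
  assumes "symmetric_form (*\<^sub>R) n \<Lambda>"
  shows "complex_poly n \<Lambda> (Re z *\<^sub>R x, Im z *\<^sub>R x) = z ^ n * of_real (diag n \<Lambda> x)"
  using complex_poly_scale[OF assms, of z "(x, 0)"]
  by (simp add: complex_scale_def complexify_real[OF assms])

lemma complex_poly_imag:
  fixes \<Lambda> :: "'a::real_vector multiset \<Rightarrow> real"
  assumes "symmetric_form (*\<^sub>R) n \<Lambda>"
  shows "complex_poly n \<Lambda> (0, x) = \<i> ^ n * of_real (diag n \<Lambda> x)"
  using complex_poly_scale_real[OF assms, of \<i> x] by simp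

lemma continuous_diag:
  fixes \<Lambda> :: "'a::euclidean_space multiset \<Rightarrow> real"
  assumes "symmetric_form (*\<^sub>R) n \<Lambda>"
  shows "continuous_on S (diag n \<Lambda>)"
proof -
  have "continuous_on S (\<lambda>x. Re (complex_poly n \<Lambda> (x, 0)))"
    by (intro continuous_intros continuous_complex_poly[OF assms])
  then show ?thesis by (simp add: complexify_real[OF assms])
qed

lemma complex_poly_along_line:
  fixes \<Lambda> :: "'a::real_vector multiset \<Rightarrow> real"
  assumes "symmetric_form (*\<^sub>R) n \<Lambda>"
  obtains p where "degree p \<le> n" "coeff p n = of_real (diag n \<Lambda> v)"
    "\<And>z. poly p z = complex_poly n \<Lambda> (x + Re z *\<^sub>R v, y + Im z *\<^sub>R v)"
    "n \<noteq> 0 \<Longrightarrow> coeff p 1 = of_nat n * complex_poly (n - 1) (insert_arg v \<Lambda>) (x, y)"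
proof -
  have "complexify \<Lambda> (add_mset (v, 0) (replicate_mset (n - 1) (x, y))) =
      complex_poly (n - 1) (insert_arg v \<Lambda>) (x, y)" if "n \<noteq> 0"
    using complexify_add_real[OF assms, of "replicate_mset (n - 1) (x, y)" v] that by simp
  then show ?thesis
    using symmetric_form_along_line[OF symmetric_form_complexify[OF assms], of "(x, y)" "(v, 0)"] that
    by (auto simp: complexify_real[OF assms] complex_scale_def)
qed

text \<open>
The connected component of \<open>e\<close> in the complement of the zero set; for a polynomial hyperbolic in the
direction \<open>e\<close> this is its Garding cone. Hyperbolicity is expressed below by the condition that the
polynomial has no zero at \<open>x + ie\<close> for real \<open>x\<close>, which by homogeneity says that all roots of
\<open>t \<mapsto> f (x + t e)\<close> are real.
\<close>

definition cone_at :: "nat \<Rightarrow> ('a::euclidean_space multiset \<Rightarrow> real) \<Rightarrow> 'a \<Rightarrow> 'a set" where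
  "cone_at n \<Lambda> e = connected_component_set {x. diag n \<Lambda> x \<noteq> 0} e"

lemma cone_at_nonzero: "y \<in> cone_at n \<Lambda> e \<Longrightarrow> diag n \<Lambda> y \<noteq> 0"
  unfolding cone_at_def using connected_component_subset by blast

lemma cone_at_base: "y \<in> cone_at n \<Lambda> e \<Longrightarrow> e \<in> cone_at n \<Lambda> e"
  by (metis (mono_tags, lifting) cone_at_def connected_component_refl_eq connected_component_in mem_Collect_eq)

lemma cone_at_rebase: "y \<in> cone_at n \<Lambda> e \<Longrightarrow> cone_at n \<Lambda> y = cone_at n \<Lambda> e"
  unfolding cone_at_def by (rule connected_component_eq)

text \<open>
This is the heart of the theory of hyperbolic polynomials. Fix \<open>x\<close> and \<open>\<alpha>\<close>, and let \<open>y\<close> move in the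
cone, starting at \<open>e\<close>. The polynomial \<open>P y\<close> in \<open>z\<close> has constant degree \<open>n\<close>, as its top coefficient
\<open>f(y)\<close> does not vanish on the cone. It has no real root, because for real \<open>z\<close> the argument has
imaginary part \<open>\<alpha> e\<close>. Hence no root can cross the real axis, and since \<open>P e\<close> has no root in the
closed upper half-plane, neither has any \<open>P y\<close>.

Instead of following roots, the cone is covered by two closed sets: \<open>C1\<close>, where \<open>P y\<close> has a root in
the closed upper half-plane, and \<open>C2\<close>, where \<open>P y\<close> obeys the lower bound which holds in the absence
of such roots. They are disjoint on the cone, so that one of them misses this connected set.
\<close>

lemma complex_poly_nonzero_on_tube:
  fixes \<Lambda> :: "'a::euclidean_space multiset \<Rightarrow> real"
  assumes form: "symmetric_form (*\<^sub>R) n \<Lambda>"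
    and hyp: "\<And>x. complex_poly n \<Lambda> (x, e) \<noteq> 0"
    and y: "y \<in> cone_at n \<Lambda> e" and \<alpha>: "\<alpha> > 0" and z: "Im z \<ge> 0"
  shows "complex_poly n \<Lambda> (x + Re z *\<^sub>R y, \<alpha> *\<^sub>R e + Im z *\<^sub>R y) \<noteq> 0"
proof -
  define F where "F = complex_poly n \<Lambda>"
  define P where "P y z = F (x + Re z *\<^sub>R y, \<alpha> *\<^sub>R e + Im z *\<^sub>R y)" for y z
  let ?\<Gamma> = "cone_at n \<Lambda> e"
  have scale: "F (r *\<^sub>R u, r *\<^sub>R v) = of_real r ^ n * F (u, v)" for r u v
    unfolding F_def by (rule complex_poly_scaleR[OF form])
  have contF: "continuous_on S h \<Longrightarrow> continuous_on S (\<lambda>x. F (h x))"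
    for S :: "'b::topological_space set" and h
    unfolding F_def by (rule continuous_complex_poly[OF form])
  have pos: "F (u, r *\<^sub>R e) \<noteq> 0" if "r > 0" for u r
    using scale[of r "(1 / r) *\<^sub>R u" e] that hyp by (simp add: F_def)
  have real_z: "P y z \<noteq> 0" if "Im z = 0" for y z
    using pos[OF \<alpha>] that by (simp add: P_def)

  \<comment> \<open>\<open>Q\<close> compactifies the closed upper half-plane: a point \<open>(a, b)\<close> with \<open>a > 0\<close> represents \<open>z = b / a\<close>,
    and \<open>a = 0\<close> represents infinity, where \<open>H\<close> reduces to the leading coefficient. Closedness of \<open>C1\<close>
    is then a projection along a compact set.\<close>
  define Q where "Q = sphere (0 :: real \<times> complex) 1 \<inter> {q. 0 \<le> fst q} \<inter> {q. 0 \<le> Im (snd q)}"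
  define H where "H q y = F (fst q *\<^sub>R x + Re (snd q) *\<^sub>R y, fst q *\<^sub>R \<alpha> *\<^sub>R e + Im (snd q) *\<^sub>R y)"
    for q :: "real \<times> complex" and y
  define C1 where "C1 = {y. \<exists>q. q \<in> Q \<and> (q, y) \<in> {(q, y). H q y = 0}}"
  define C2 where "C2 = {y. \<forall>z. Im z > 0 \<longrightarrow> \<bar>diag n \<Lambda> y\<bar> * Im z ^ n \<le> norm (P y z)}"
  have "compact Q"
    unfolding Q_def
    by (intro compact_Int_closed compact_sphere closed_Collect_le continuous_intros)
  moreover have "closed {(q, y). H q y = 0}"
  proof -
    have "continuous_on UNIV (\<lambda>p. H (fst p) (snd p))"
      unfolding H_def by (intro contF continuous_intros)
    then have "closed {p. H (fst p) (snd p) = 0}"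
      by (intro closed_Collect_eq continuous_intros)
    then show ?thesis by (simp add: case_prod_unfold)
  qed
  ultimately have "closed C1"
    unfolding C1_def by (rule closed_compact_projection)
  have "closed C2"
    unfolding C2_def P_def
    by (intro closed_Collect_all closed_Collect_imp open_Collect_const closed_Collect_le
        continuous_intros contF continuous_diag[OF form])

  have C1_I: "y \<in> C1" if "P y z = 0" "Im z \<ge> 0" for y z
  proof -
    define r where "r = 1 / norm (1 :: real, z)"
    have r: "r > 0" by (simp add: r_def zero_prod_def)
    define q where "q = r *\<^sub>R (1 :: real, z)"
    have "H q y = F (r *\<^sub>R (x + Re z *\<^sub>R y), r *\<^sub>R (\<alpha> *\<^sub>R e + Im z *\<^sub>R y))"
      by (simp add: H_def q_def algebra_simps)
    then have "H q y = 0"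
      using that by (simp add: scale P_def)
    moreover have "norm q = 1"
      using r by (simp add: q_def r_def zero_prod_def del: scaleR_Pair)
    then have "q \<in> Q"
      using r that by (simp add: Q_def) (simp add: q_def)
    ultimately show ?thesis unfolding C1_def by blast
  qed
  have C1_D: "\<exists>z. Im z \<ge> 0 \<and> P y z = 0" if yC1: "y \<in> C1" and nz: "diag n \<Lambda> y \<noteq> 0" for y
  proof -
    obtain q where "q \<in> Q" "H q y = 0"
      using yC1 unfolding C1_def by blast
    then obtain a b where q: "(a, b) \<in> Q" "H (a, b) y = 0"
      by (cases q) blast
    have ab: "a \<ge> 0" "Im b \<ge> 0" "(a, b) \<noteq> 0"
      using q(1) by (auto simp: Q_def)
    show ?thesis
    proof (cases "a = 0")
      case True
      then have "b ^ n * of_real (diag n \<Lambda> y) = 0"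
        using q(2) complex_poly_scale_real[OF form, of b y] by (simp add: H_def F_def)
      then show ?thesis using nz True ab by (auto simp: zero_prod_def)
    next
      case False
      then have a: "a > 0" using ab by simp
      have "H (a, b) y = F (a *\<^sub>R (x + Re (b / a) *\<^sub>R y), a *\<^sub>R (\<alpha> *\<^sub>R e + Im (b / a) *\<^sub>R y))"
        using a by (simp add: H_def scaleR_add_right Re_divide_of_real Im_divide_of_real)
      then have "of_real a ^ n * P y (b / a) = 0"
        using q(2) unfolding scale P_def by simp
      then have "P y (b / a) = 0" using a by simp
      moreover have "Im (b / a) \<ge> 0" using a ab by (simp add: Im_divide_of_real)
      ultimately show ?thesis by blast
    qed
  qed

  have cover: "y \<in> C2" if "y \<in> ?\<Gamma>" "y \<notin> C1" for y
  proof -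
    obtain p where p: "degree p \<le> n" "coeff p n = of_real (diag n \<Lambda> y)"
      "\<And>z. poly p z = P y z"
      using complex_poly_along_line[OF form, of y x "\<alpha> *\<^sub>R e"] unfolding P_def F_def by blast
    have d: "degree p = n"
      using p cone_at_nonzero[OF that(1)] by (metis le_antisym le_degree of_real_eq_0_iff)
    have "Im r \<le> 0" if "poly p r = 0" for r
      using C1_I[of y r] \<open>y \<notin> C1\<close> that p(3) by force
    then show ?thesis
      using norm_poly_ge_of_roots[of p] p(2,3) d by (auto simp: C2_def)
  qed
  have disjoint: False if "y \<in> ?\<Gamma>" "y \<in> C1" "y \<in> C2" for y
  proof -
    have nz: "diag n \<Lambda> y \<noteq> 0" using cone_at_nonzero[OF that(1)] .
    have "\<exists>z. Im z \<ge> 0 \<and> P y z = 0"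
      using C1_D[OF that(2) nz] .
    then obtain z where z: "Im z \<ge> 0" "P y z = 0" by blast
    then have "Im z > 0" using real_z[of z y] by force
    then have "\<bar>diag n \<Lambda> y\<bar> * Im z ^ n \<le> 0"
      using that(3) z by (force simp: C2_def)
    then show False using nz zero_less_power[OF \<open>Im z > 0\<close>, of n] by (simp add: mult_le_0_iff)
  qed
  have "e \<in> ?\<Gamma>" using y by (rule cone_at_base)
  have "e \<notin> C1"
  proof
    assume "e \<in> C1"
    then obtain z where z: "Im z \<ge> 0" "P e z = 0"
      using C1_D cone_at_nonzero[OF \<open>e \<in> ?\<Gamma>\<close>] by blast
    then show False
      using pos[of "\<alpha> + Im z" "x + Re z *\<^sub>R e"] \<alpha> by (simp add: P_def scaleR_add_left)
  qed
  have "connected ?\<Gamma>" by (simp add: cone_at_def)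
  then have "\<not> (C1 \<inter> ?\<Gamma> \<noteq> {} \<and> C2 \<inter> ?\<Gamma> \<noteq> {})"
    using \<open>closed C1\<close> \<open>closed C2\<close> cover disjoint unfolding connected_closed by blast
  moreover have "C2 \<inter> ?\<Gamma> \<noteq> {}"
    using cover \<open>e \<in> ?\<Gamma>\<close> \<open>e \<notin> C1\<close> by blast
  ultimately have "y \<notin> C1" using y by blast
  then show ?thesis
    using C1_I z unfolding P_def F_def by blast
qed

text \<open>
The form of hyperbolicity that passes to derivatives: no zeros in the tube of all \<open>x + iy\<close> with \<open>y\<close>
in a cone \<open>C\<close>. The cone is kept fixed while the polynomial is differentiated; the larger cones of
the derivatives never have to be determined.
\<close>

definition stable_on :: "'a::real_vector set \<Rightarrow> nat \<Rightarrow> ('a multiset \<Rightarrow> real) \<Rightarrow> bool" where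
  "stable_on C n \<Lambda> \<longleftrightarrow> (\<forall>x. \<forall>y\<in>C. complex_poly n \<Lambda> (x, y) \<noteq> 0)"

text \<open>
Closure under addition and under multiplication by strictly positive numbers: open cones, which
in general do not contain 0, qualify.
\<close>

definition positive_cone :: "'a::real_vector set \<Rightarrow> bool" where
  "positive_cone C \<longleftrightarrow> (\<forall>x\<in>C. \<forall>y\<in>C. x + y \<in> C) \<and> (\<forall>x\<in>C. \<forall>t>0. t *\<^sub>R x \<in> C)"

lemma open_cone_at:
  assumes "symmetric_form (*\<^sub>R) n \<Lambda>"
  shows "open (cone_at n \<Lambda> e)"
proof -
  have "open {x. diag n \<Lambda> x \<noteq> 0}"
    by (intro open_Collect_neq continuous_diag[OF assms] continuous_intros)
  then show ?thesis
    unfolding cone_at_def by (rule open_connected_component)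
qed

text \<open>
Since the cone is open, \<open>iy\<close> can be split as \<open>i t e + i (y - t e)\<close> with both summands in the cone,
which is the situation of \<open>complex_poly_nonzero_on_tube\<close> with \<open>z = i\<close>.
\<close>

lemma stable_on_cone_at:
  fixes \<Lambda> :: "'a::euclidean_space multiset \<Rightarrow> real"
  assumes form: "symmetric_form (*\<^sub>R) n \<Lambda>"
    and hyp: "\<And>x. complex_poly n \<Lambda> (x, e) \<noteq> 0"
  shows "stable_on (cone_at n \<Lambda> e) n \<Lambda>"
  unfolding stable_on_def
proof (intro allI ballI)
  fix x y assume y: "y \<in> cone_at n \<Lambda> e"
  have "isCont (\<lambda>t::real. y - t *\<^sub>R e) 0"
    by (intro continuous_intros)
  then have "((\<lambda>t::real. y - t *\<^sub>R e) \<longlongrightarrow> y) (at 0)"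
    by (simp add: isCont_def)
  then have "\<forall>\<^sub>F t in at 0. y - t *\<^sub>R e \<in> cone_at n \<Lambda> e"
    using open_cone_at[OF form] y by (rule topological_tendstoD)
  then have "\<forall>\<^sub>F t in at_right 0. y - t *\<^sub>R e \<in> cone_at n \<Lambda> e"
    by (rule filter_leD[OF at_le, rotated]) simp
  moreover have "\<forall>\<^sub>F t in at_right 0. (t::real) > 0"
    by (rule eventually_at_right_less)
  ultimately obtain t where t: "t > 0" "y - t *\<^sub>R e \<in> cone_at n \<Lambda> e"
    using eventually_happens'[OF _ eventually_conj] trivial_limit_at_right_real by blast
  show "complex_poly n \<Lambda> (x, y) \<noteq> 0"
    using complex_poly_nonzero_on_tube[OF form hyp t(2) t(1), of \<i> x] by simp
qed

text \<open>
By \<open>stable_on_cone_at\<close>, every \<open>u\<close> in the cone may replace \<open>e\<close> as the direction of hyperbolicity.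
Applying \<open>complex_poly_nonzero_on_tube\<close> at \<open>u\<close> with \<open>x = 0\<close> and purely imaginary \<open>z\<close> shows that the
polynomial does not vanish on the ray \<open>u + t v\<close>, so this ray stays in the component.
\<close>

lemma positive_cone_cone_at:
  fixes \<Lambda> :: "'a::euclidean_space multiset \<Rightarrow> real"
  assumes form: "symmetric_form (*\<^sub>R) n \<Lambda>"
    and hyp: "\<And>x. complex_poly n \<Lambda> (x, e) \<noteq> 0"
  shows "positive_cone (cone_at n \<Lambda> e)"
proof -
  have segment: "v \<in> cone_at n \<Lambda> e"
    if u: "u \<in> cone_at n \<Lambda> e" and nz: "\<And>t. 0 \<le> t \<Longrightarrow> t \<le> 1 \<Longrightarrow> diag n \<Lambda> (u + t *\<^sub>R (v - u)) \<noteq> 0"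
    for u v
  proof -
    have "(1 - t) *\<^sub>R u + t *\<^sub>R v = u + t *\<^sub>R (v - u)" for t
      by (simp add: algebra_simps)
    then have "closed_segment u v \<subseteq> {x. diag n \<Lambda> x \<noteq> 0}"
      using nz by (auto simp: in_segment)
    then have "closed_segment u v \<subseteq> cone_at n \<Lambda> u"
      unfolding cone_at_def by (intro connected_component_maximal) auto
    then show ?thesis using cone_at_rebase[OF u] by auto
  qed
  show ?thesis
    unfolding positive_cone_def
  proof (intro conjI ballI allI impI)
    fix u v assume u: "u \<in> cone_at n \<Lambda> e" and v: "v \<in> cone_at n \<Lambda> e"
    have hyp_u: "\<And>x. complex_poly n \<Lambda> (x, u) \<noteq> 0"
      using stable_on_cone_at[OF form hyp] u by (auto simp: stable_on_def)
    have v': "v \<in> cone_at n \<Lambda> u" using v cone_at_rebase[OF u] by simp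
    have "diag n \<Lambda> (u + t *\<^sub>R v) \<noteq> 0" if "0 \<le> t" for t
      using complex_poly_nonzero_on_tube[OF form hyp_u v', of 1 "t *\<^sub>R \<i>" 0] that
      by (simp add: complex_poly_imag[OF form])
    then show "u + v \<in> cone_at n \<Lambda> e" by (intro segment[OF u]) simp
  next
    fix u and t :: real assume u: "u \<in> cone_at n \<Lambda> e" and t: "t > 0"
    show "t *\<^sub>R u \<in> cone_at n \<Lambda> e"
    proof (rule segment[OF u])
      fix s :: real assume s: "0 \<le> s" "s \<le> 1"
      have "0 < (1 - s) + s * t"
        using s t by (cases "s = 0") (auto intro: add_nonneg_pos)
      moreover have "u + s *\<^sub>R (t *\<^sub>R u - u) = ((1 - s) + s * t) *\<^sub>R u"
        by (simp add: algebra_simps)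
      moreover have "complex_of_real (diag n \<Lambda> (r *\<^sub>R u)) = of_real r ^ n * of_real (diag n \<Lambda> u)" for r
        using complex_poly_scale_real[OF form, of "of_real r" u] by (simp add: complexify_real[OF form])
      ultimately show "diag n \<Lambda> (u + s *\<^sub>R (t *\<^sub>R u - u)) \<noteq> 0"
        using cone_at_nonzero[OF u] by (metis mult_eq_0_iff of_real_eq_0_iff order_less_irrefl power_not_zero)
    qed
  qed
qed

section \<open>The Garding inequality\<close>

text \<open>
Fixing one argument \<open>v\<close> of the polarization is, up to a factor, differentiation in the direction
\<open>v\<close>. On the line \<open>(x + iy) + z v\<close> all roots lie in the open lower half-plane, as otherwise the
argument would stay in the tube; so the derivative at \<open>z = 0\<close> does not vanish by Gauss-Lucas.
\<close>

lemma stable_on_insert_arg: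
  fixes \<Lambda> :: "'a::real_vector multiset \<Rightarrow> real"
  assumes form: "symmetric_form (*\<^sub>R) (Suc n) \<Lambda>" and C: "positive_cone C"
    and stable: "stable_on C (Suc n) \<Lambda>" and v: "v \<in> C"
  shows "stable_on C n (insert_arg v \<Lambda>)"
  unfolding stable_on_def
proof (intro allI ballI)
  fix x y assume y: "y \<in> C"
  obtain p where p: "degree p \<le> Suc n" "coeff p (Suc n) = of_real (diag (Suc n) \<Lambda> v)"
    "\<And>z. poly p z = complex_poly (Suc n) \<Lambda> (x + Re z *\<^sub>R v, y + Im z *\<^sub>R v)"
    "coeff p 1 = of_nat (Suc n) * complex_poly n (insert_arg v \<Lambda>) (x, y)"
    using complex_poly_along_line[OF form, of v x y] by (metis diff_Suc_1 nat.distinct(1))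
  have "diag (Suc n) \<Lambda> v \<noteq> 0"
    using stable v complex_poly_imag[OF form, of v] by (metis mult_zero_right of_real_0 stable_on_def)
  then have "degree p \<noteq> 0"
    using p(2) by (metis coeff_eq_0 nat.distinct(1) gr0I of_real_eq_0_iff zero_less_Suc)
  moreover have "Im r < 0" if "poly p r = 0" for r
  proof (rule ccontr)
    assume "\<not> Im r < 0"
    then have "y + Im r *\<^sub>R v \<in> C"
      using C v y by (cases "Im r = 0") (auto simp: positive_cone_def)
    then show False using stable that p(3) by (auto simp: stable_on_def)
  qed
  ultimately show "complex_poly n (insert_arg v \<Lambda>) (x, y) \<noteq> 0"
    using coeff_1_nonzero_of_roots[of p] p(4) by force
qed

text \<open>
Fix the arguments one after another: stability is inherited by \<open>stable_on_insert_arg\<close>, and the sign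
by the intermediate value theorem, since a stable polynomial has no zero on a segment in the cone.
\<close>

lemma stable_form_pos:
  fixes \<Lambda> :: "'a::euclidean_space multiset \<Rightarrow> real"
  assumes "symmetric_form (*\<^sub>R) n \<Lambda>" "positive_cone C" "stable_on C n \<Lambda>"
    and "e \<in> C" "diag n \<Lambda> e > 0" "set_mset X \<subseteq> C" "size X = n"
  shows "\<Lambda> X > 0"
  using assms
proof (induction n arbitrary: \<Lambda> X e)
  case (Suc n)
  obtain v Y where X: "X = add_mset v Y" "size Y = n"
    using \<open>size X = Suc n\<close> by (cases X) auto
  have v: "v \<in> C" "set_mset Y \<subseteq> C" using Suc.prems(6) X by auto
  have nz: "diag (Suc n) \<Lambda> y \<noteq> 0" if "y \<in> C" for y
    using Suc.prems(3) that complex_poly_imag[OF Suc.prems(1), of y]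
    by (metis mult_zero_right of_real_0 stable_on_def)
  have "diag (Suc n) \<Lambda> v > 0"
  proof (rule ccontr)
    assume "\<not> diag (Suc n) \<Lambda> v > 0"
    then have le: "diag (Suc n) \<Lambda> v \<le> 0" by simp
    have seg: "(1 - t) *\<^sub>R v + t *\<^sub>R e \<in> C" if "0 \<le> t" "t \<le> 1" for t
      using that Suc.prems(2,4) v(1)
      by (cases "t = 0"; cases "t = 1") (auto simp: positive_cone_def)
    have "\<exists>t\<ge>0. t \<le> 1 \<and> diag (Suc n) \<Lambda> ((1 - t) *\<^sub>R v + t *\<^sub>R e) = 0"
    proof (rule IVT')
      show "continuous_on {0..1} (\<lambda>t::real. diag (Suc n) \<Lambda> ((1 - t) *\<^sub>R v + t *\<^sub>R e))"
        by (rule continuous_on_compose2[OF continuous_diag[OF Suc.prems(1), of UNIV]])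
          (auto intro!: continuous_intros)
    qed (use le Suc.prems(5) in auto)
    then show False using nz seg by blast
  qed
  then have "diag n (insert_arg v \<Lambda>) v > 0" by (simp add: insert_arg_def)
  then have "insert_arg v \<Lambda> Y > 0"
    using Suc.IH[OF symmetric_form_insert_arg[OF Suc.prems(1)] Suc.prems(2)
        stable_on_insert_arg[OF Suc.prems(1-3) v(1)] v(1)] v(2) X(2) by blast
  then show ?case by (simp add: X insert_arg_def)
qed simp

lemma garding_inequality:
  fixes \<Lambda> :: "'a::euclidean_space multiset \<Rightarrow> real"
  assumes "symmetric_form (*\<^sub>R) n \<Lambda>" "\<And>x. complex_poly n \<Lambda> (x, e) \<noteq> 0" "diag n \<Lambda> e > 0"
    and "set_mset X \<subseteq> cone_at n \<Lambda> e" "size X = n"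
  shows "\<Lambda> X > 0"
proof (rule stable_form_pos[OF assms(1) positive_cone_cone_at stable_on_cone_at])
  show "e \<in> cone_at n \<Lambda> e"
    using assms(3) by (simp add: cone_at_def connected_component_refl_eq)
qed (use assms in auto)

section \<open>Null directions\<close>

lemma symmetric_form_nonneg_closure:
  fixes \<Lambda> :: "'a::euclidean_space multiset \<Rightarrow> real"
  assumes form: "symmetric_form (*\<^sub>R) (Suc n) \<Lambda>"
    and nonneg: "\<And>X. set_mset X \<subseteq> C \<Longrightarrow> size X = Suc n \<Longrightarrow> \<Lambda> X \<ge> 0"
    and "x \<in> closure C" "set_mset Y \<subseteq> C" "size Y = n"
  shows "\<Lambda> (add_mset x Y) \<ge> 0"
proof -
  have "linear (\<lambda>x. \<Lambda> (add_mset x Y))"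
    using symmetric_form_linear[OF form] assms(5) by simp
  then have "continuous_on (closure C) (\<lambda>x. \<Lambda> (add_mset x Y))"
    by (simp add: linear_continuous_on linear_conv_bounded_linear)
  then show ?thesis
    by (rule continuous_ge_on_closure[OF _ assms(3)]) (use nonneg assms in auto)
qed

text \<open>
A linear functional that is nonnegative on an open cone and vanishes at one of its points is zero,
because the points \<open>c + t w\<close> and \<open>c - t w\<close> both stay in the cone for small \<open>t\<close>. The lemma applies
this slot by slot.
\<close>

lemma nonneg_form_eq_zero:
  fixes \<Lambda> :: "'a::euclidean_space multiset \<Rightarrow> real"
  assumes "symmetric_form (*\<^sub>R) n \<Lambda>" "open C"
    and "\<And>X. set_mset X \<subseteq> C \<Longrightarrow> size X = n \<Longrightarrow> \<Lambda> X \<ge> 0"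
    and "set_mset X \<subseteq> C" "size X = n" "\<Lambda> X = 0" "size Y = n"
  shows "\<Lambda> Y = 0"
  using assms
proof (induction n arbitrary: \<Lambda> X Y)
  case (Suc n)
  note form = Suc.prems(1)
  obtain c X' where X: "X = add_mset c X'" "size X' = n" "c \<in> C" "set_mset X' \<subseteq> C"
    using Suc.prems(4,5) by (cases X) auto
  have nonneg: "insert_arg v \<Lambda> Z \<ge> 0" if "v \<in> C" "set_mset Z \<subseteq> C" "size Z = n" for v Z
    using Suc.prems(3)[of "add_mset v Z"] that by (simp add: insert_arg_def)
  have IH: "insert_arg v \<Lambda> Z = 0" if "v \<in> C" "insert_arg v \<Lambda> X' = 0" "size Z = n" for v Z
    using Suc.IH[OF symmetric_form_insert_arg[OF form] Suc.prems(2) nonneg[OF that(1)] X(4,2) that(2,3)] .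
  have lin: "linear (\<lambda>v. \<Lambda> (add_mset v Z))" if "size Z = n" for Z
    using symmetric_form_linear[OF form] that by simp
  have perturb: "\<exists>t>0. c + t *\<^sub>R v \<in> C" for v
  proof -
    obtain r where r: "r > 0" "ball c r \<subseteq> C" using Suc.prems(2) X(3) open_contains_ball by blast
    define t where "t = r / (norm v + 1) / 2"
    have "t > 0" using r by (simp add: t_def add_nonneg_pos)
    have "t * norm v < r"
    proof -
      have "t * norm v \<le> t * (norm v + 1)" using \<open>t > 0\<close> by simp
      also have "\<dots> = r / 2" by (simp add: t_def add_nonneg_eq_0_iff field_simps)
      finally show ?thesis using r by simp
    qed
    then have "c + t *\<^sub>R v \<in> ball c r" using \<open>t > 0\<close> by (simp add: dist_norm)
    then show ?thesis using r \<open>t > 0\<close> by blast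
  qed
  \<comment> \<open>The first slot, with the other arguments kept at their given values.\<close>
  have zero_X': "\<Lambda> (add_mset v X') = 0" for v
  proof -
    have ge: "\<Lambda> (add_mset w X') \<ge> 0" for w
    proof -
      obtain t where t: "t > 0" "c + t *\<^sub>R w \<in> C" using perturb by blast
      have "\<Lambda> (add_mset (c + t *\<^sub>R w) X') = \<Lambda> (add_mset c X') + t * \<Lambda> (add_mset w X')"
        using symmetric_formD[OF form, of X'] X(2) by simp
      then have "t * \<Lambda> (add_mset w X') \<ge> 0"
        using nonneg[OF t(2) X(4,2)] Suc.prems(6) X(1) by (simp add: insert_arg_def)
      then show ?thesis using t(1) by (simp add: zero_le_mult_iff)
    qed
    show ?thesis
      using ge[of v] ge[of "- v"] linear_neg[OF lin[OF X(2)], of v] by simp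
  qed
  \<comment> \<open>With the first argument in \<open>C\<close>, the induction hypothesis frees the remaining slots.\<close>
  have zero_C: "\<Lambda> (add_mset v Z) = 0" if "v \<in> C" "size Z = n" for v Z
    using IH[OF that(1) _ that(2)] zero_X' by (simp add: insert_arg_def)
  \<comment> \<open>An arbitrary first argument is a multiple of a difference of two elements of \<open>C\<close>.\<close>
  obtain v Z where Y: "Y = add_mset v Z" "size Z = n"
    using Suc.prems(7) by (cases Y) auto
  obtain t where t: "t > 0" "c + t *\<^sub>R v \<in> C" using perturb by blast
  have "\<Lambda> (add_mset (c + t *\<^sub>R v) Z) = \<Lambda> (add_mset c Z) + t * \<Lambda> (add_mset v Z)"
    using symmetric_formD[OF form, of Z] Y(2) by simp
  then show ?case
    using zero_C[OF t(2) Y(2)] zero_C[OF X(3) Y(2)] t(1) by (simp add: Y)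
qed simp

lemma diag_add_null:
  fixes \<Lambda> :: "'a::real_vector multiset \<Rightarrow> real"
  assumes "symmetric_form (*\<^sub>R) n \<Lambda>" "\<And>X. Suc (size X) = n \<Longrightarrow> \<Lambda> (add_mset v X) = 0"
  shows "diag n \<Lambda> (x + v) = diag n \<Lambda> x"
  using assms
proof (induction n arbitrary: \<Lambda>)
  case (Suc n)
  have "\<Lambda> (add_mset (x + v) (replicate_mset n (x + v))) = \<Lambda> (add_mset x (replicate_mset n (x + v)))"
    using symmetric_formD[OF Suc.prems(1), of "replicate_mset n (x + v)" x 1 v] Suc.prems(2) by simp
  also have "\<dots> = \<Lambda> (add_mset x (replicate_mset n x))"
    using Suc.IH[OF symmetric_form_insert_arg[OF Suc.prems(1), of x]] Suc.prems(2)
    by (simp add: insert_arg_def add_mset_commute[of x v])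
  finally show ?case by simp
qed simp

section \<open>Existence of the polarization\<close>

text \<open>
Homogeneous polynomial functions as sums of products of \<open>d\<close> linear functionals. This inductive
description makes the construction of the polarization a structural induction.
\<close>

inductive homogeneous_function :: "nat \<Rightarrow> ('a::real_normed_vector \<Rightarrow> real) \<Rightarrow> bool" where
  const: "homogeneous_function 0 (\<lambda>_. c)"
| times_linear: "bounded_linear l \<Longrightarrow> homogeneous_function d f \<Longrightarrow>
    homogeneous_function (Suc d) (\<lambda>x. l x * f x)"
| add: "homogeneous_function d f \<Longrightarrow> homogeneous_function d g \<Longrightarrow>
    homogeneous_function d (\<lambda>x. f x + g x)"

lemma homogeneous_function_zero: "homogeneous_function d (\<lambda>_. 0)"
proof (induction d)
  case (Suc d)
  show ?case
    using homogeneous_function.times_linear[OF bounded_linear_zero Suc.IH] by simp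
qed (rule homogeneous_function.const)

lemma homogeneous_function_cmult:
  "homogeneous_function d f \<Longrightarrow> homogeneous_function d (\<lambda>x. c * f x)"
proof (induction rule: homogeneous_function.induct)
  case (const b)
  then show ?case by (rule homogeneous_function.const)
next
  case (times_linear l d f)
  then show ?case
    using homogeneous_function.times_linear[of l d "\<lambda>x. c * f x"] by (simp add: mult.left_commute)
next
  case (add d f g)
  then show ?case
    using homogeneous_function.add[of d "\<lambda>x. c * f x" "\<lambda>x. c * g x"] by (simp add: distrib_left)
qed

lemma homogeneous_function_mult:
  "homogeneous_function d f \<Longrightarrow> homogeneous_function e g \<Longrightarrow>
    homogeneous_function (d + e) (\<lambda>x. f x * g x)"
proof (induction rule: homogeneous_function.induct)
  case (const c)
  then show ?case by (simp add: homogeneous_function_cmult)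
next
  case (times_linear l d f)
  then show ?case
    using homogeneous_function.times_linear[of l "d + e" "\<lambda>x. f x * g x"] by (simp add: mult.assoc)
next
  case (add d f h)
  then show ?case
    using homogeneous_function.add[of "d + e" "\<lambda>x. f x * g x" "\<lambda>x. h x * g x"]
    by (simp add: distrib_right)
qed

lemma homogeneous_function_sum:
  "(\<And>i. i \<in> I \<Longrightarrow> homogeneous_function d (f i)) \<Longrightarrow> homogeneous_function d (\<lambda>x. \<Sum>i\<in>I. f i x)"
proof (induction I rule: infinite_finite_induct)
  case (insert i I)
  then show ?case
    using homogeneous_function.add[of d "f i" "\<lambda>x. \<Sum>i\<in>I. f i x"] by simp
qed (simp_all add: homogeneous_function_zero)

lemma homogeneous_function_scaleR:
  "homogeneous_function d f \<Longrightarrow> f (t *\<^sub>R x) = t ^ d * f x"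
  by (induction rule: homogeneous_function.induct)
    (simp_all add: linear_cmul bounded_linear.linear algebra_simps)

text \<open>
\<open>P x\<close> is the polynomial \<open>t \<mapsto> p (t x)\<close>, whose coefficients are the homogeneous components of \<open>p\<close> at
\<open>x\<close>. Collecting them in one polynomial lets polynomial multiplication do the bookkeeping for products.
\<close>

lemma real_polynomial_function_components:
  fixes p :: "'a::real_normed_vector \<Rightarrow> real"
  assumes "real_polynomial_function p"
  shows "\<exists>P. (\<forall>d. homogeneous_function d (\<lambda>x. coeff (P x) d)) \<and> (\<forall>x. poly (P x) 1 = p x)"
  using assms
proof (induction rule: real_polynomial_function.induct)
  case (linear l)
  have 1: "homogeneous_function (Suc 0) l"
    using homogeneous_function.times_linear[OF linear homogeneous_function.const[of 1]] by simp
  have "homogeneous_function d (\<lambda>x. coeff [:0, l x:] d)" for d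
    using 1 homogeneous_function_zero
    by (cases d; cases "d - 1") simp_all
  then show ?case by (intro exI[of _ "\<lambda>x. [:0, l x:]"]) simp
next
  case (const c)
  have "homogeneous_function d (\<lambda>x::'a. coeff [:c:] d)" for d
    using homogeneous_function.const homogeneous_function_zero by (cases d) simp_all
  then show ?case by (intro exI[of _ "\<lambda>x. [:c:]"]) simp
next
  case (add f g)
  then obtain P Q where "\<And>d. homogeneous_function d (\<lambda>x. coeff (P x) d)" "\<And>x. poly (P x) 1 = f x"
    "\<And>d. homogeneous_function d (\<lambda>x. coeff (Q x) d)" "\<And>x. poly (Q x) 1 = g x" by metis
  then show ?case
    by (intro exI[of _ "\<lambda>x. P x + Q x"]) (simp add: homogeneous_function.add)
next
  case (mult f g)
  then obtain P Q where PQ: "\<And>d. homogeneous_function d (\<lambda>x. coeff (P x) d)" "\<And>x. poly (P x) 1 = f x"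
    "\<And>d. homogeneous_function d (\<lambda>x. coeff (Q x) d)" "\<And>x. poly (Q x) 1 = g x" by metis
  have "homogeneous_function d (\<lambda>x. coeff (P x * Q x) d)" for d
  proof -
    have "homogeneous_function d (\<lambda>x. coeff (P x) i * coeff (Q x) (d - i))" if "i \<in> {..d}" for i
      using homogeneous_function_mult[OF PQ(1)[of i] PQ(3)[of "d - i"]] that by simp
    then show ?thesis unfolding coeff_mult by (rule homogeneous_function_sum)
  qed
  then show ?case
    by (intro exI[of _ "\<lambda>x. P x * Q x"]) (simp add: PQ)
qed

lemma homogeneous_functionI:
  assumes "real_polynomial_function p" and hom: "\<And>t x. p (t *\<^sub>R x) = t ^ N * p x"
  shows "homogeneous_function N p"
proof -
  obtain P where P: "\<And>d. homogeneous_function d (\<lambda>x. coeff (P x) d)" "\<And>x. poly (P x) 1 = p x"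
    using real_polynomial_function_components[OF assms(1)] by blast
  have "poly (P x) t = poly (monom (p x) N) t" for x t
  proof -
    have "P (t *\<^sub>R x) = pcompose (P x) [:0, t:]"
      using homogeneous_function_scaleR[OF P(1)] by (intro poly_eqI) (simp add: coeff_pcompose_linear)
    then have "p (t *\<^sub>R x) = poly (P x) t"
      by (simp flip: P(2) add: poly_pcompose)
    then show ?thesis by (simp add: hom poly_monom mult.commute)
  qed
  then have "P x = monom (p x) N" for x
    by (simp add: poly_eq_poly_eq_iff[symmetric] fun_eq_iff)
  then have "coeff (P x) N = p x" for x by simp
  then show ?thesis using P(1)[of N] by simp
qed

text \<open>
If \<open>\<Lambda>\<close> polarizes \<open>f\<close>, then \<open>l * f\<close> is polarized by the average, over the choice of the argument \<open>x\<close>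
that is fed to \<open>l\<close>, of \<open>l x\<close> times \<open>\<Lambda>\<close> of the other arguments.
\<close>

lemma homogeneous_function_polarize:
  "homogeneous_function d f \<Longrightarrow> \<exists>\<Lambda>. symmetric_form (*\<^sub>R) d \<Lambda> \<and> (\<forall>x. f x = diag d \<Lambda> x)"
proof (induction rule: homogeneous_function.induct)
  case (const c)
  show ?case by (rule exI[of _ "\<lambda>_. c"]) (simp add: symmetric_form_def)
next
  case (add d f g)
  then obtain \<Lambda> M where "symmetric_form (*\<^sub>R) d \<Lambda>" "symmetric_form (*\<^sub>R) d M"
    "\<And>x. f x = diag d \<Lambda> x" "\<And>x. g x = diag d M x" by blast
  then show ?case
    by (intro exI[of _ "\<lambda>X. \<Lambda> X + M X"]) (auto simp: symmetric_form_def algebra_simps)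
next
  case (times_linear l d f)
  then obtain \<Lambda> where form: "symmetric_form (*\<^sub>R) d \<Lambda>" and f: "\<And>x. f x = diag d \<Lambda> x" by blast
  define S where "S X = (\<Sum>x\<in>#X. l x * \<Lambda> (X - {#x#}))" for X
  have S_add: "S (add_mset w X) = l w * \<Lambda> X + (\<Sum>x\<in>#X. l x * \<Lambda> (add_mset w (X - {#x#})))" for w X
  proof -
    have "(\<Sum>x\<in>#X. l x * \<Lambda> (add_mset w X - {#x#})) = (\<Sum>x\<in>#X. l x * \<Lambda> (add_mset w (X - {#x#})))"
      by (intro arg_cong[of _ _ sum_mset] image_mset_cong) simp
    then show ?thesis by (simp add: S_def)
  qed
  have "S (add_mset (u + c *\<^sub>R v) X) = S (add_mset u X) + c * S (add_mset v X)" if "size X = d" for u v c X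
  proof -
    have "\<Lambda> (add_mset (u + c *\<^sub>R v) (X - {#x#})) =
        \<Lambda> (add_mset u (X - {#x#})) + c * \<Lambda> (add_mset v (X - {#x#}))" if "x \<in># X" for x
      using symmetric_formD[OF form, of "X - {#x#}"] that \<open>size X = d\<close>
      by (metis size_Suc_Diff1)
    then have "(\<Sum>x\<in>#X. l x * \<Lambda> (add_mset (u + c *\<^sub>R v) (X - {#x#}))) =
        (\<Sum>x\<in>#X. l x * \<Lambda> (add_mset u (X - {#x#})) + c * (l x * \<Lambda> (add_mset v (X - {#x#}))))"
      by (intro arg_cong[of _ _ sum_mset] image_mset_cong) (simp add: algebra_simps)
    then show ?thesis
      using times_linear(1)
      by (simp add: S_add sum_mset.distrib sum_mset_distrib_left linear_add linear_cmul
          bounded_linear.linear algebra_simps)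
  qed
  then have "symmetric_form (*\<^sub>R) (Suc d) (\<lambda>X. S X / Suc d)"
    by (simp add: symmetric_form_def add_divide_distrib)
  moreover have "l x * f x = S (replicate_mset (Suc d) x) / Suc d" for x
  proof -
    have "S (replicate_mset (Suc d) x) = (\<Sum>y\<in>#replicate_mset (Suc d) x. l x * \<Lambda> (replicate_mset d x))"
      unfolding S_def by (intro arg_cong[of _ _ sum_mset] image_mset_cong) (auto split: if_splits)
    then show ?thesis by (simp add: f field_simps)
  qed
  ultimately show ?case by (intro exI[of _ "\<lambda>X. S X / Suc d"]) simp
qed

section \<open>Symmetric matrices\<close>

text \<open>
The orthogonal projection onto symmetric matrices. Composition with it extends polynomials from the
subspace of symmetric matrices to the space of all matrices, to which the general theory applies.
\<close>

definition symm :: "real^'n^'n \<Rightarrow> real^'n^'n" where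
  "symm A = (1/2) *\<^sub>R (A + transpose A)"

lemma transpose_add_scaleR:
  fixes A B :: "real^'n^'n"
  shows "transpose (A + B) = transpose A + transpose B" "transpose (r *\<^sub>R A) = r *\<^sub>R transpose A"
  by (simp_all add: transpose_def vec_eq_iff)

lemma linear_symm: "linear symm"
  by (intro linearI) (simp_all add: symm_def transpose_add_scaleR algebra_simps)

lemma symm_in_sym_mats [simp]: "symm A \<in> sym_mats"
  by (simp add: symm_def sym_mats_def transpose_add_scaleR add.commute)

lemma symm_id: "A \<in> sym_mats \<Longrightarrow> symm A = A"
  by (simp add: symm_def sym_mats_def flip: scaleR_2)

lemma subspace_sym_mats: "subspace sym_mats"
  by (rule subspaceI) (simp_all add: sym_mats_def transpose_add_scaleR, simp add: transpose_def vec_eq_iff)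

lemma mat_1_sym [simp]: "mat 1 \<in> sym_mats"
  by (simp add: sym_mats_def transpose_mat)

lemma inner_transpose_matrix:
  fixes A B :: "real^'n^'n"
  shows "transpose A \<bullet> B = A \<bullet> transpose B"
  unfolding inner_vec_def transpose_def by (simp, rule sum.swap)

lemma inner_symm: "symm A \<bullet> B = A \<bullet> symm B"
  by (simp add: symm_def inner_add_left inner_add_right inner_transpose_matrix)

lemma mat_inner_eq_inner: "B \<in> sym_mats \<Longrightarrow> mat_inner A B = A \<bullet> B"
  by (simp add: mat_inner_def sym_mats_def trace_def matrix_matrix_mult_def inner_vec_def
      transpose_def vec_eq_iff)

definition outer :: "real^'n \<Rightarrow> real^'n^'n" where
  "outer v = (\<chi> i j. v $ i * v $ j)"

lemma outer_sym [simp]: "outer v \<in> sym_mats"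
  by (simp add: sym_mats_def outer_def transpose_def vec_eq_iff mult.commute)

lemma outer_mult_vec: "outer v *v x = (v \<bullet> x) *\<^sub>R v"
  by (simp add: outer_def matrix_vector_mult_def vec_eq_iff inner_vec_def sum_distrib_left
      mult_ac)

lemma qform_outer: "qform (outer v) x = (v \<bullet> x)\<^sup>2"
  by (simp add: qform_def outer_mult_vec power2_eq_square inner_commute)

lemma mat_inner_outer: "mat_inner A (outer v) = qform A v"
  unfolding mat_inner_eq_inner[OF outer_sym]
  by (simp add: qform_def inner_vec_def outer_def matrix_vector_mult_def sum_distrib_left mult_ac)

lemma qform_add: "qform (A + B) x = qform A x + qform B x"
  by (simp add: qform_def matrix_vector_mult_add_rdistrib inner_add_right)

lemma qform_scaleR: "qform (r *\<^sub>R A) x = r * qform A x"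
  by (simp add: qform_def scaleR_matrix_vector_assoc[symmetric])

lemma qform_mat_1: "qform (mat 1) x = (norm x)\<^sup>2"
  by (simp add: qform_def power2_norm_eq_inner)

lemma qform_smult: "qform A (r *\<^sub>R x) = r\<^sup>2 * qform A x"
  by (simp add: qform_def matrix_vector_mult_scaleR power2_eq_square)

section \<open>The polarization of a Garding-Dirichlet polynomial\<close>

lemma is_polarization_of_form:
  assumes form: "symmetric_form (*\<^sub>R) N \<Lambda>" and diag: "\<And>A. A \<in> sym_mats \<Longrightarrow> diag N \<Lambda> A = g A"
  shows "is_polarization N g (\<lambda>As. \<Lambda> (mset As))"
proof -
  have "\<Lambda> (mset (As[i := s *\<^sub>R A + t *\<^sub>R B])) = s * \<Lambda> (mset (As[i := A])) + t * \<Lambda> (mset (As[i := B]))"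
    if "length As = N" "i < N" for As i A B s t
  proof -
    let ?X = "mset As - {#As ! i#}"
    have lin: "linear (\<lambda>A. \<Lambda> (add_mset A ?X))"
      using symmetric_form_linear[OF form] that by (simp add: size_Diff_singleton)
    show ?thesis
      using that linear_add[OF lin] linear_cmul[OF lin] by (simp add: mset_update)
  qed
  then show ?thesis
    using diag by (simp add: is_polarization_def)
qed

lemma is_polarization_polarization:
  assumes "homogeneous_poly_on UNIV N g"
  shows "is_polarization N g (polarization N g)"
proof -
  obtain p where p: "real_polynomial_function p" "\<And>A. A \<in> sym_mats \<Longrightarrow> g A = p A"
    and hom: "\<And>A t. A \<in> sym_mats \<Longrightarrow> g (t *\<^sub>R A) = t ^ N * g A"
    using assms by (auto simp: homogeneous_poly_on_def Sym2_UNIV)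
  have "polynomial_function symm"
    by (intro polynomial_function_bounded_linear) (simp add: linear_symm linear_conv_bounded_linear[symmetric])
  then have "real_polynomial_function (p \<circ> symm)"
    using p(1) by (rule real_polynomial_function_compose)
  moreover have "(p \<circ> symm) (t *\<^sub>R A) = t ^ N * (p \<circ> symm) A" for t A
    using hom[of "symm A" t] p(2)[of "symm A"] p(2)[of "t *\<^sub>R symm A"]
      subspace_scale[OF subspace_sym_mats, of "symm A" t]
    by (simp add: linear_cmul[OF linear_symm])
  ultimately have "homogeneous_function N (p \<circ> symm)"
    by (rule homogeneous_functionI)
  then obtain \<Lambda> where \<Lambda>: "symmetric_form (*\<^sub>R) N \<Lambda>" "\<And>A. (p \<circ> symm) A = diag N \<Lambda> A"
    using homogeneous_function_polarize by blast
  have "diag N \<Lambda> A = g A" if "A \<in> sym_mats" for A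
    using \<Lambda>(2)[of A] p(2)[OF that] symm_id[OF that] by simp
  then have "is_polarization N g (\<lambda>As. \<Lambda> (mset As))"
    by (rule is_polarization_of_form[OF \<Lambda>(1)])
  then show ?thesis unfolding polarization_def by (rule someI[of "is_polarization N g"])
qed

text \<open>
The polarization as a multilinear form on all matrices: symmetrization extends it from symmetric
matrices, and the choice of an enumeration of the multiset is harmless by its symmetry.
\<close>

definition polar_form :: "nat \<Rightarrow> (real^'n^'n \<Rightarrow> real) \<Rightarrow> (real^'n^'n) multiset \<Rightarrow> real" where
  "polar_form N g X = polarization N g (map symm (SOME As. mset As = X))"

lemma polar_form_mset:
  assumes "is_polarization N g (polarization N g)" "length As = N"
  shows "polar_form N g (mset As) = polarization N g (map symm As)"
proof -
  define Bs where "Bs = (SOME Bs. mset Bs = mset As)"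
  have "mset Bs = mset As" unfolding Bs_def by (rule someI) simp
  then have "mset (map symm Bs) = mset (map symm As)" by simp
  moreover have "length (map symm As) = N" "set (map symm As) \<subseteq> sym_mats"
    using assms(2) by auto
  ultimately have "polarization N g (map symm Bs) = polarization N g (map symm As)"
    using assms(1) unfolding is_polarization_def by blast
  then show ?thesis by (simp add: polar_form_def Bs_def)
qed

lemma polar_form_sym:
  assumes "is_polarization N g (polarization N g)" "length As = N" "set As \<subseteq> sym_mats"
  shows "polar_form N g (mset As) = polarization N g As"
proof -
  have "map symm As = As" using assms(3) by (induction As) (auto simp: symm_id)
  then show ?thesis using polar_form_mset[OF assms(1,2)] by simp
qed

lemma polar_form_diag:
  assumes "is_polarization N g (polarization N g)"
  shows "diag N (polar_form N g) A = g (symm A)"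
  using polar_form_mset[OF assms, of "replicate N A"] assms by (simp add: is_polarization_def)

lemma symmetric_form_polar_form:
  fixes g :: "real^'n^'n \<Rightarrow> real"
  assumes pol: "is_polarization N g (polarization N g)"
  shows "symmetric_form (*\<^sub>R) N (polar_form N g)"
  unfolding symmetric_form_def
proof (intro allI impI)
  fix A B :: "real^'n^'n" and c and X :: "(real^'n^'n) multiset" assume X: "Suc (size X) = N"
  obtain As where As: "mset As = X" using ex_mset by blast
  then have len: "Suc (length As) = N" using X by auto
  have val: "polar_form N g (add_mset C X) = polarization N g (symm C # map symm As)" for C
    using polar_form_mset[OF pol, of "C # As"] As len by simp
  have lin: "polarization N g (Bs[i := s *\<^sub>R A + t *\<^sub>R B]) =
      s * polarization N g (Bs[i := A]) + t * polarization N g (Bs[i := B])"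
    if "length Bs = N" "set Bs \<subseteq> sym_mats" "A \<in> sym_mats" "B \<in> sym_mats" "i < N" for Bs A B s t i
    using pol that unfolding is_polarization_def by blast
  show "polar_form N g (add_mset (A + c *\<^sub>R B) X) =
      polar_form N g (add_mset A X) + c * polar_form N g (add_mset B X)"
    using lin[of "symm A # map symm As" "symm A" "symm B" 0 1 c] len symm_in_sym_mats
    by (simp add: image_subset_iff val linear_add[OF linear_symm] linear_cmul[OF linear_symm])
qed

text \<open>
Existence is the Riesz representation of the extended functional, given by its adjoint; the
symmetric part of the representing matrix represents the same functional on symmetric matrices.
\<close>

lemma polar_mat:
  fixes g :: "real^'n^'n \<Rightarrow> real"
  assumes pol: "is_polarization N g (polarization N g)" and N: "N \<ge> 1"
    and Gs: "length Gs = N - 1" "set Gs \<subseteq> sym_mats"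
  shows "polar_mat N g Gs \<in> sym_mats"
    and "A \<in> sym_mats \<Longrightarrow> mat_inner (polar_mat N g Gs) A = polarization N g (Gs @ [A])"
proof -
  let ?R = "\<lambda>M. M \<in> sym_mats \<and> (\<forall>A\<in>sym_mats. mat_inner M A = polarization N g (Gs @ [A]))"
  define \<phi> where "\<phi> A = polar_form N g (add_mset A (mset Gs))" for A
  have "linear \<phi>"
    unfolding \<phi>_def using symmetric_form_linear[OF symmetric_form_polar_form[OF pol]] Gs(1) N by simp
  have \<phi>: "\<phi> A = polarization N g (Gs @ [A])" if "A \<in> sym_mats" for A
    using polar_form_sym[OF pol, of "Gs @ [A]"] Gs N that by (simp add: \<phi>_def)
  have "mat_inner (symm (adjoint \<phi> 1)) A = polarization N g (Gs @ [A])" if "A \<in> sym_mats" for A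
  proof -
    have "symm (adjoint \<phi> 1) \<bullet> A = A \<bullet> adjoint \<phi> 1"
      using that by (simp add: inner_symm symm_id inner_commute[of A])
    then show ?thesis
      using adjoint_works[OF \<open>linear \<phi>\<close>, of A 1] that by (simp add: mat_inner_eq_inner \<phi>)
  qed
  then have ex: "?R (symm (adjoint \<phi> 1))" by simp
  have uniq: "M = M'" if "?R M" "?R M'" for M M'
  proof -
    have "M - M' \<in> sym_mats" using that subspace_diff[OF subspace_sym_mats] by blast
    then have "M \<bullet> (M - M') = M' \<bullet> (M - M')"
      using that by (metis mat_inner_eq_inner)
    then have "(M - M') \<bullet> (M - M') = 0" by (simp add: inner_diff_left)
    then show ?thesis by simp
  qed
  have "?R (polar_mat N g Gs)"
    unfolding polar_mat_def by (rule theI[of ?R, OF ex]) (rule uniq[OF _ ex])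
  then show "polar_mat N g Gs \<in> sym_mats"
    and "A \<in> sym_mats \<Longrightarrow> mat_inner (polar_mat N g Gs) A = polarization N g (Gs @ [A])"
    by auto
qed

text \<open>
Consecutive terms of \<open>a k\<close>, the polarization at \<open>k\<close> copies of \<open>A\<close> and \<open>N - k\<close> copies of \<open>B\<close>, differ
in one argument only, which turns the sum into a telescope from \<open>g B = a 0\<close> to \<open>g A = a N\<close>.
\<close>

lemma polarization_telescope:
  assumes pol: "is_polarization N g (polarization N g)" and N: "N \<ge> 1"
    and A: "A \<in> sym_mats" and B: "B \<in> sym_mats"
  shows "(\<Sum>k = 0..N - 1. polarization N g (replicate k A @ replicate (N - 1 - k) B @ [A - B])) = g A - g B"
proof -
  have repl: "set (replicate k A @ replicate l B @ Cs) \<subseteq> sym_mats" if "set Cs \<subseteq> sym_mats" for k l Cs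
    using A B that by (auto dest: in_set_replicate[THEN iffD1])
  define a where "a k = polarization N g (replicate k A @ replicate (N - k) B)" for k
  have "polarization N g (replicate k A @ replicate (N - 1 - k) B @ [A - B]) = a (Suc k) - a k"
    if k: "k \<le> N - 1" for k
  proof -
    let ?X = "replicate_mset k A + replicate_mset (N - 1 - k) B"
    have "linear (\<lambda>C. polar_form N g (add_mset C ?X))"
      using symmetric_form_linear[OF symmetric_form_polar_form[OF pol]] k N by simp
    then have "polar_form N g (add_mset (A - B) ?X) = polar_form N g (add_mset A ?X) - polar_form N g (add_mset B ?X)"
      by (rule linear_diff)
    moreover have "polar_form N g (add_mset (A - B) ?X) =
        polarization N g (replicate k A @ replicate (N - 1 - k) B @ [A - B])"
      using polar_form_sym[OF pol, of "replicate k A @ replicate (N - 1 - k) B @ [A - B]"] k N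
        repl[of "[A - B]"] subspace_diff[OF subspace_sym_mats A B] by simp
    moreover have "polar_form N g (add_mset A ?X) = a (Suc k)"
      using polar_form_sym[OF pol, of "replicate (Suc k) A @ replicate (N - Suc k) B"] k N
        repl[of "[]" "Suc k" "N - Suc k"] by (simp add: a_def)
    moreover have "polar_form N g (add_mset B ?X) = a k"
    proof -
      have "N - k = Suc (N - 1 - k)" using k N by simp
      then show ?thesis
        using polar_form_sym[OF pol, of "replicate k A @ replicate (N - k) B"] k N
          repl[of "[]" k "N - k"] by (simp add: a_def)
    qed
    ultimately show ?thesis by simp
  qed
  then have "(\<Sum>k = 0..N - 1. polarization N g (replicate k A @ replicate (N - 1 - k) B @ [A - B]))
      = (\<Sum>k = 0..N - 1. a (Suc k) - a k)" by simp
  also have "\<dots> = a (Suc (N - 1)) - a 0" by (rule sum_Suc_diff) simp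
  also have "\<dots> = g A - g B"
    using pol A B N by (simp add: a_def is_polarization_def)
  finally show ?thesis .
qed

section \<open>The cone of a Garding-Dirichlet polynomial\<close>

text \<open>
The real polynomial \<open>t \<mapsto> f (t e + x)\<close> and the complex polynomial \<open>z \<mapsto> f (x + z e)\<close> agree on the
real line, hence everywhere; so a zero at \<open>x + ie\<close> would make \<open>\<i>\<close> a root of the former.
\<close>

lemma complex_poly_nonzero_of_real_roots:
  fixes \<Lambda> :: "'a::real_vector multiset \<Rightarrow> real"
  assumes form: "symmetric_form (*\<^sub>R) n \<Lambda>"
    and real: "all_roots_real (\<lambda>t. diag n \<Lambda> (t *\<^sub>R e + x))"
  shows "complex_poly n \<Lambda> (x, e) \<noteq> 0"
proof
  assume zero: "complex_poly n \<Lambda> (x, e) = 0"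
  obtain p where p: "\<And>t. diag n \<Lambda> (t *\<^sub>R e + x) = poly p t"
    "\<And>z. poly (map_poly complex_of_real p) z = 0 \<Longrightarrow> z \<in> \<real>"
    using real unfolding all_roots_real_def by blast
  obtain q where q: "\<And>z. poly q z = complex_poly n \<Lambda> (x + Re z *\<^sub>R e, Im z *\<^sub>R e)"
    using complex_poly_along_line[OF form, of e x 0] by (metis add_0)
  have "poly q (of_real t) = poly (map_poly of_real p) (of_real t)" for t
  proof -
    have "poly (map_poly complex_of_real p) (of_real t) = of_real (poly p t)"
      by (induction p) (simp_all add: map_poly_pCons)
    then show ?thesis
      by (simp add: q complexify_real[OF form] p(1)[symmetric] add.commute)
  qed
  then have "range complex_of_real \<subseteq> {z. poly (q - map_poly of_real p) z = 0}"
    by auto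
  moreover have "infinite (range complex_of_real)"
    by (simp add: finite_image_iff inj_of_real infinite_UNIV_char_0)
  ultimately have "q - map_poly of_real p = 0"
    using poly_roots_finite finite_subset by blast
  then have "poly (map_poly of_real p) \<i> = 0"
    using q[of \<i>] zero by simp
  then show False using p(2) complex_is_Real_iff by fastforce
qed

lemma garding_cone_subset_sym_mats: "garding_cone UNIV g \<subseteq> sym_mats"
  unfolding garding_cone_def Sym2_UNIV using connected_component_subset by blast

lemma garding_cone_subset_cone_at:
  assumes "is_polarization N g (polarization N g)"
  shows "garding_cone UNIV g \<subseteq> cone_at N (polar_form N g) (mat 1)"
proof -
  have "garding_cone UNIV g \<subseteq> {A. diag N (polar_form N g) A \<noteq> 0}"
  proof
    fix A assume "A \<in> garding_cone UNIV g"
    then have "A \<in> sym_mats" "g A \<noteq> 0"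
      using connected_component_subset unfolding garding_cone_def Sym2_UNIV by blast+
    then show "A \<in> {A. diag N (polar_form N g) A \<noteq> 0}"
      by (simp add: polar_form_diag[OF assms] symm_id)
  qed
  moreover have "mat 1 \<in> garding_cone UNIV g \<or> garding_cone UNIV g = {}"
    unfolding garding_cone_def id_form_UNIV
    using connected_component_refl_eq[of "{A \<in> Sym2 UNIV. g A \<noteq> 0}" "mat 1"]
      connected_component_eq_empty[of "{A \<in> Sym2 UNIV. g A \<noteq> 0}" "mat 1"] by blast
  moreover have "connected (garding_cone UNIV g)"
    by (simp add: garding_cone_def)
  ultimately show ?thesis
    unfolding cone_at_def using connected_component_maximal by blast
qed

lemma garding_dirichlet_polarization:
  fixes g :: "real^'n^'n \<Rightarrow> real"
  assumes gd: "garding_dirichlet UNIV N g"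
  shows "is_polarization N g (polarization N g)"
    and "complex_poly N (polar_form N g) (X, mat 1) \<noteq> 0"
    and "diag N (polar_form N g) (mat 1) > 0"
proof -
  show pol: "is_polarization N g (polarization N g)"
    using gd is_polarization_polarization by (auto simp: garding_dirichlet_def)
  have "all_roots_real (\<lambda>t. diag N (polar_form N g) (t *\<^sub>R mat 1 + X))"
    using gd by (simp add: garding_dirichlet_def Sym2_UNIV id_form_UNIV polar_form_diag[OF pol]
        linear_add[OF linear_symm] linear_cmul[OF linear_symm] symm_id)
  then show "complex_poly N (polar_form N g) (X, mat 1) \<noteq> 0"
    by (rule complex_poly_nonzero_of_real_roots[OF symmetric_form_polar_form[OF pol]])
  show "diag N (polar_form N g) (mat 1) > 0"
    using gd by (simp add: polar_form_diag[OF pol] symm_id garding_dirichlet_def id_form_UNIV)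
qed

section \<open>Restriction to a hyperplane\<close>

definition hyperplane_proj :: "real^'n \<Rightarrow> real^'n^'n" where
  "hyperplane_proj v = mat 1 - outer v"

definition hyperplane_restrict :: "real^'n \<Rightarrow> real^'n^'n \<Rightarrow> real^'n^'n" where
  "hyperplane_restrict v A = hyperplane_proj v ** A ** hyperplane_proj v"

lemma hyperplane_proj_mult: "hyperplane_proj v *v x = x - (v \<bullet> x) *\<^sub>R v"
  by (simp add: hyperplane_proj_def matrix_vector_mult_diff_rdistrib outer_mult_vec)

lemma hyperplane_proj_sym: "hyperplane_proj v \<in> sym_mats"
  unfolding hyperplane_proj_def by (intro subspace_diff[OF subspace_sym_mats]) simp_all

lemma qform_hyperplane_restrict:
  "qform (hyperplane_restrict v A) x = qform A (x - (v \<bullet> x) *\<^sub>R v)"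
  using sym_mats_inner[OF hyperplane_proj_sym[of v], of x]
  by (simp add: qform_def hyperplane_restrict_def hyperplane_proj_mult flip: matrix_vector_mul_assoc)

lemma linear_hyperplane_restrict: "linear (hyperplane_restrict v)"
  by (intro linearI; subst matrix_eq)
    (simp_all add: hyperplane_restrict_def matrix_vector_mult_add_rdistrib matrix_vector_right_distrib
      matrix_vector_mult_scaleR flip: matrix_vector_mul_assoc scaleR_matrix_vector_assoc)

lemma hyperplane_restrict_sym:
  assumes "A \<in> sym_mats"
  shows "hyperplane_restrict v A \<in> sym_mats"
  using assms hyperplane_proj_sym[of v]
  by (simp add: hyperplane_restrict_def sym_mats_def matrix_transpose_mul matrix_mul_assoc)

lemma restrict_form_hyperplane:
  assumes v: "norm v = 1" and A: "A \<in> sym_mats"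
  shows "restrict_form {x. v \<bullet> x = 0} A = hyperplane_restrict v A"
  unfolding restrict_form_def
proof (rule the1_equality[OF ex1_restrict_form[OF A subspace_hyperplane]], intro conjI ballI)
  have "v \<bullet> (x - (v \<bullet> x) *\<^sub>R v) = 0" for x
    using v by (simp add: inner_diff_right norm_eq_1)
  then show "hyperplane_restrict v A \<in> Sym2 {x. v \<bullet> x = 0}"
    using hyperplane_restrict_sym[OF A]
    by (simp add: Sym2_def hyperplane_restrict_def hyperplane_proj_mult flip: matrix_vector_mul_assoc)
qed (simp add: qform_hyperplane_restrict)

lemma hyperplane_restrict_id:
  assumes "norm v = 1" and A: "A \<in> Sym2 {x. v \<bullet> x = 0}"
  shows "hyperplane_restrict v A = A"
proof -
  have "restrict_form {x. v \<bullet> x = 0} A = A"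
    unfolding restrict_form_def
    by (rule the1_equality[OF ex1_restrict_form[OF _ subspace_hyperplane]])
      (use A in \<open>auto simp: Sym2_def\<close>)
  then show ?thesis
    using restrict_form_hyperplane[OF assms(1)] A by (simp add: Sym2_def)
qed

text \<open>
The polynomial on the hyperplane is \<open>g\<close> itself, evaluated on \<open>Sym2 V\<close>. Restriction is a linear map
which preserves the values of \<open>g\<close> and fixes \<open>Sym2 V\<close> pointwise. It carries the identity to the
identity, the cone (as a connected set) into the cone, and therefore closure into closure, so that
every defining property of a Garding-Dirichlet polynomial descends to \<open>V\<close>.
\<close>

lemma not_complete_of_restriction_invariant:
  fixes g :: "real^'n^'n \<Rightarrow> real"
  assumes gd: "garding_dirichlet UNIV N g" and v: "norm v = 1"
    and inv: "\<And>A. A \<in> sym_mats \<Longrightarrow> g (hyperplane_restrict v A) = g A"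
  shows "\<not> complete_garding g"
proof -
  define V where "V = {x. v \<bullet> x = 0}"
  let ?r = "hyperplane_restrict v"
  have restrict: "restrict_form V A = ?r A" if "A \<in> sym_mats" for A
    unfolding V_def using restrict_form_hyperplane[OF v that] .
  have sub: "Sym2 V \<subseteq> sym_mats" by (auto simp: Sym2_def)
  have r_id: "?r A = A" if "A \<in> Sym2 V" for A
    using hyperplane_restrict_id[OF v] that by (simp add: V_def)
  have r_Sym2: "?r A \<in> Sym2 V" if "A \<in> sym_mats" for A
  proof -
    have "subspace V" unfolding V_def by (rule subspace_hyperplane)
    then have "restrict_form V A \<in> Sym2 V"
      unfolding restrict_form_def using theI'[OF ex1_restrict_form[OF that]] by blast
    then show ?thesis using restrict[OF that] by simp
  qed
  have id: "id_form V = ?r (mat 1)" by (simp add: id_form_def restrict)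
  have "garding_dirichlet V N g"
    unfolding garding_dirichlet_def
  proof (intro conjI ballI)
    show "homogeneous_poly_on V N g"
      using gd sub by (fastforce simp: garding_dirichlet_def homogeneous_poly_on_def Sym2_UNIV)
    show "g (id_form V) > 0"
      using gd inv[of "mat 1"] by (simp add: garding_dirichlet_def id id_form_UNIV)
  next
    fix A assume A: "A \<in> Sym2 V"
    have "g (t *\<^sub>R id_form V + A) = g (t *\<^sub>R mat 1 + A)" for t
    proof -
      have "t *\<^sub>R id_form V + A = ?r (t *\<^sub>R mat 1 + A)"
        using r_id[OF A]
        by (simp add: id linear_add[OF linear_hyperplane_restrict] linear_cmul[OF linear_hyperplane_restrict])
      moreover have "t *\<^sub>R mat 1 + A \<in> sym_mats"
        using A sub by (intro subspace_add[OF subspace_sym_mats] subspace_scale[OF subspace_sym_mats]) auto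
      ultimately show ?thesis using inv by simp
    qed
    then show "all_roots_real (\<lambda>t. g (t *\<^sub>R id_form V + A))"
      using gd A sub by (auto simp: garding_dirichlet_def Sym2_UNIV id_form_UNIV)
  next
    have "?r ` garding_cone UNIV g \<subseteq> garding_cone V g"
    proof -
      have ne: "mat 1 \<in> garding_cone UNIV g"
        using gd by (simp add: garding_dirichlet_def garding_cone_def id_form_UNIV Sym2_UNIV
            connected_component_refl_eq)
      have conn: "connected (?r ` garding_cone UNIV g)"
        by (intro connected_continuous_image linear_continuous_on)
          (simp_all add: garding_cone_def linear_hyperplane_restrict flip: linear_conv_bounded_linear)
      have "?r ` garding_cone UNIV g \<subseteq> {A \<in> Sym2 V. g A \<noteq> 0}"
        using connected_component_subset[of "{A \<in> sym_mats. g A \<noteq> 0}" "mat 1"]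
        by (auto simp: garding_cone_def Sym2_UNIV id_form_UNIV inv r_Sym2 image_subset_iff)
      then show ?thesis
        unfolding garding_cone_def[of V] id using ne conn by (intro connected_component_maximal) auto
    qed
    then have closure: "?r ` closure (garding_cone UNIV g) \<subseteq> closure (garding_cone V g)"
      using closure_bounded_linear_image_subset[of ?r "garding_cone UNIV g"] closure_mono
        linear_hyperplane_restrict by (meson linear_conv_bounded_linear subset_trans)
    show "{A \<in> Sym2 V. \<forall>v\<in>V. qform A v \<ge> 0} \<subseteq> closure (garding_cone V g)"
    proof
      fix A assume A: "A \<in> {A \<in> Sym2 V. \<forall>v\<in>V. qform A v \<ge> 0}"
      have "qform A x \<ge> 0" for x
      proof -
        have "x - (v \<bullet> x) *\<^sub>R v \<in> V" using v by (simp add: V_def inner_diff_right norm_eq_1)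
        then show ?thesis
          using A qform_hyperplane_restrict[of v A x] r_id by auto
      qed
      then have "A \<in> closure (garding_cone UNIV g)"
        using gd A sub by (auto simp: garding_dirichlet_def Sym2_UNIV)
      then show "A \<in> closure (garding_cone V g)"
        using closure A r_id by force
    qed
  qed
  moreover have "v \<notin> V" using v by (simp add: V_def norm_eq_1)
  moreover have "subspace V" unfolding V_def by (rule subspace_hyperplane)
  ultimately show ?thesis
    unfolding complete_garding_def using restrict inv by (metis UNIV_I)
qed

section \<open>Positivity\<close>

text \<open>
A form \<open>D\<close> vanishing on the hyperplane orthogonal to \<open>v\<close> is controlled by \<open>a = v \<bullet> x\<close>: writing
\<open>x = a v + u\<close> leaves only terms containing \<open>a\<close>, of size at most \<open>2 \<kappa> \<bar>a\<bar> \<parallel>x\<parallel> + \<kappa> a\<^sup>2\<close>. A large multiple of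
\<open>a\<^sup>2\<close> together with a \<^emph>\<open>small\<close> multiple of \<open>\<parallel>x\<parallel>\<^sup>2\<close> dominates these. The coefficient of the identity
tends to 0 as \<open>t\<close> grows, while the coefficient of \<open>outer v\<close> is harmless once that matrix is a null
direction.
\<close>

lemma qform_perturb_nonneg:
  assumes D: "D \<in> sym_mats" and v: "norm v = 1" and zero: "\<And>x. v \<bullet> x = 0 \<Longrightarrow> qform D x = 0"
    and t: "t > 0"
  defines "\<kappa> \<equiv> norm (D *v v)"
  shows "qform ((t + \<kappa>) *\<^sub>R outer v + D + (\<kappa>\<^sup>2 / t) *\<^sub>R mat 1) x \<ge> 0"
proof -
  define a where "a = v \<bullet> x"
  have "v \<bullet> (x - a *\<^sub>R v) = 0" using v by (simp add: a_def inner_diff_right norm_eq_1)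
  then have "qform D (x - a *\<^sub>R v) = 0" by (rule zero)
  moreover have "v \<bullet> (D *v x) = x \<bullet> (D *v v)"
    using sym_mats_inner[OF D, of v x] by (simp add: inner_commute)
  ultimately have D_x: "qform D x = 2 * a * (x \<bullet> (D *v v)) - a\<^sup>2 * (v \<bullet> (D *v v))"
    by (simp add: qform_def matrix_vector_mult_diff_distrib matrix_vector_mult_scaleR inner_diff_left
        inner_diff_right power2_eq_square algebra_simps)
  have "\<bar>2 * a * (x \<bullet> (D *v v))\<bar> \<le> 2 * \<bar>a\<bar> * (norm x * \<kappa>)"
    using Cauchy_Schwarz_ineq2[of x "D *v v"] by (simp add: abs_mult \<kappa>_def mult_left_mono)
  moreover have "a\<^sup>2 * (v \<bullet> (D *v v)) \<le> a\<^sup>2 * \<kappa>"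
    using norm_cauchy_schwarz[of v "D *v v"] v by (intro mult_left_mono) (simp_all add: \<kappa>_def)
  moreover have "2 * \<bar>a\<bar> * (norm x * \<kappa>) \<le> t * a\<^sup>2 + \<kappa>\<^sup>2 / t * (norm x)\<^sup>2"
  proof -
    have "0 \<le> (t * \<bar>a\<bar> - \<kappa> * norm x)\<^sup>2 / t" using t by simp
    also have "\<dots> = t * a\<^sup>2 + \<kappa>\<^sup>2 / t * (norm x)\<^sup>2 - 2 * \<bar>a\<bar> * (norm x * \<kappa>)"
      using t by (simp add: power2_eq_square field_simps)
    finally show ?thesis by simp
  qed
  moreover have "qform ((t + \<kappa>) *\<^sub>R outer v + D + (\<kappa>\<^sup>2 / t) *\<^sub>R mat 1) x =
      (t + \<kappa>) * a\<^sup>2 + qform D x + \<kappa>\<^sup>2 / t * (norm x)\<^sup>2"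
    by (simp add: qform_add qform_scaleR qform_outer qform_mat_1 a_def)
  moreover have "(t + \<kappa>) * a\<^sup>2 = t * a\<^sup>2 + a\<^sup>2 * \<kappa>"
    by (simp add: algebra_simps)
  ultimately show ?thesis using D_x by linarith
qed

lemma nonneg_of_add_inverse_nonneg:
  fixes a b :: real
  assumes "\<And>t. t > 0 \<Longrightarrow> a + b / t \<ge> 0"
  shows "a \<ge> 0"
proof (rule ccontr)
  assume "\<not> a \<ge> 0"
  then have a: "a < 0" by simp
  define t where "t = (\<bar>b\<bar> + 1) / (- a)"
  have t: "t > 0" using a by (simp add: t_def divide_pos_neg add_nonneg_pos)
  have "b \<ge> - a * t"
    using assms[OF t] t by (simp add: field_simps)
  also have "- a * t = \<bar>b\<bar> + 1" using a by (simp add: t_def)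
  finally show False by simp
qed

text \<open>
Nonnegativity is the Garding inequality on the closure of the cone. If the value were 0, then
\<open>outer v\<close> would be a null direction of the polarization. By \<open>qform_perturb_nonneg\<close> every form \<open>D\<close>
vanishing on the hyperplane orthogonal to \<open>v\<close> would be a null direction as well. Then \<open>g\<close> would depend
only on the restriction of its argument to this hyperplane, contrary to completeness.
\<close>

lemma polar_form_rank_one_pos:
  fixes g :: "real^'n^'n \<Rightarrow> real"
  assumes gd: "garding_dirichlet UNIV (Suc m) g" and complete: "complete_garding g"
    and v: "norm v = 1" and X: "set_mset X \<subseteq> garding_cone UNIV g" "size X = m"
  shows "polar_form (Suc m) g (add_mset (outer v) X) > 0"
proof (rule ccontr)
  assume not_pos: "\<not> polar_form (Suc m) g (add_mset (outer v) X) > 0"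
  define \<Lambda> where "\<Lambda> = polar_form (Suc m) g"
  define C where "C = cone_at (Suc m) \<Lambda> (mat 1)"
  note pol = garding_dirichlet_polarization(1)[OF gd]
  have form: "symmetric_form (*\<^sub>R) (Suc m) \<Lambda>"
    unfolding \<Lambda>_def by (rule symmetric_form_polar_form[OF pol])
  have "open C" unfolding C_def by (rule open_cone_at[OF form])
  have cone: "garding_cone UNIV g \<subseteq> C"
    unfolding C_def \<Lambda>_def by (rule garding_cone_subset_cone_at[OF pol])
  have nonneg: "\<Lambda> Z \<ge> 0" if "set_mset Z \<subseteq> C" "size Z = Suc m" for Z
    using garding_inequality[OF form, of "mat 1" Z] garding_dirichlet_polarization(2,3)[OF gd] that
    unfolding C_def \<Lambda>_def by (simp add: less_imp_le)
  have psd: "\<Lambda> (add_mset A Z) \<ge> 0"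
    if "A \<in> sym_mats" "\<And>x. qform A x \<ge> 0" "set_mset Z \<subseteq> C" "size Z = m" for A Z
  proof -
    have "A \<in> closure C"
      using gd that(1,2) closure_mono[OF cone] by (auto simp: garding_dirichlet_def Sym2_UNIV)
    then show ?thesis
      using symmetric_form_nonneg_closure[OF form nonneg] that(3,4) by blast
  qed
  have XC: "set_mset X \<subseteq> C" using X(1) cone by blast
  have null_P: "\<Lambda> (add_mset (outer v) Z) = 0" if "size Z = m" for Z
  proof -
    have "insert_arg (outer v) \<Lambda> Z = 0"
    proof (rule nonneg_form_eq_zero[OF symmetric_form_insert_arg[OF form] \<open>open C\<close> _ XC X(2) _ that])
      show "insert_arg (outer v) \<Lambda> Y \<ge> 0" if "set_mset Y \<subseteq> C" "size Y = m" for Y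
        using psd[OF outer_sym _ that] by (simp add: insert_arg_def qform_outer)
      then have "insert_arg (outer v) \<Lambda> X \<ge> 0" using XC X(2) .
      then show "insert_arg (outer v) \<Lambda> X = 0"
        using not_pos by (simp add: insert_arg_def \<Lambda>_def)
    qed
    then show ?thesis by (simp add: insert_arg_def)
  qed
  \<comment> \<open>The class of all such \<open>D\<close> is symmetric about 0, so that this inequality for \<open>D\<close> and for
    \<open>- D\<close> makes \<open>D\<close> a null direction.\<close>
  have null_ge: "\<Lambda> (add_mset D Z) \<ge> 0"
    if D: "D \<in> sym_mats" "\<And>x. v \<bullet> x = 0 \<Longrightarrow> qform D x = 0" and Z: "set_mset Z \<subseteq> C" "size Z = m"
    for D Z
  proof (rule nonneg_of_add_inverse_nonneg)
    fix t :: real assume t: "t > 0"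
    let ?\<kappa> = "norm (D *v v)"
    let ?E = "(t + ?\<kappa>) *\<^sub>R outer v + D + (?\<kappa>\<^sup>2 / t) *\<^sub>R mat 1"
    have lin: "linear (\<lambda>A. \<Lambda> (add_mset A Z))"
      using symmetric_form_linear[OF form] Z(2) by simp
    have "?E \<in> sym_mats"
      using D(1) by (intro subspace_add[OF subspace_sym_mats] subspace_scale[OF subspace_sym_mats]) auto
    then have "\<Lambda> (add_mset ?E Z) \<ge> 0"
      using qform_perturb_nonneg[OF D(1) v D(2) t] by (rule psd[OF _ _ Z])
    then show "\<Lambda> (add_mset D Z) + ?\<kappa>\<^sup>2 * \<Lambda> (add_mset (mat 1) Z) / t \<ge> 0"
      by (simp add: linear_add[OF lin] linear_cmul[OF lin] null_P[OF Z(2)])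
  qed
  have null: "\<Lambda> (add_mset D Z) = 0"
    if D: "D \<in> sym_mats" "\<And>x. v \<bullet> x = 0 \<Longrightarrow> qform D x = 0" and Z: "size Z = m" for D Z
  proof -
    have "insert_arg D \<Lambda> Z = 0"
    proof (rule nonneg_form_eq_zero[OF symmetric_form_insert_arg[OF form] \<open>open C\<close> _ XC X(2) _ Z])
      show "insert_arg D \<Lambda> Y \<ge> 0" if "set_mset Y \<subseteq> C" "size Y = m" for Y
        using null_ge[OF D that] by (simp add: insert_arg_def)
      have "- D \<in> sym_mats" using D(1) subspace_neg[OF subspace_sym_mats] by blast
      moreover have "qform (- D) x = 0" if "v \<bullet> x = 0" for x
        using D(2)[OF that] qform_scaleR[of "-1" D x] by simp
      ultimately have "\<Lambda> (add_mset (- D) X) \<ge> 0" using null_ge XC X(2) by blast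
      moreover have "\<Lambda> (add_mset (- D) X) = - \<Lambda> (add_mset D X)"
        using linear_neg[OF symmetric_form_linear[OF form, of X]] X(2) by simp
      ultimately show "insert_arg D \<Lambda> X = 0"
        using null_ge[OF D XC X(2)] by (simp add: insert_arg_def)
    qed
    then show ?thesis by (simp add: insert_arg_def)
  qed
  have "g (hyperplane_restrict v A) = g A" if A: "A \<in> sym_mats" for A
  proof -
    let ?B = "hyperplane_restrict v A"
    define D where "D = A - ?B"
    have B: "?B \<in> sym_mats" using hyperplane_restrict_sym[OF A] .
    have D: "D \<in> sym_mats" unfolding D_def by (rule subspace_diff[OF subspace_sym_mats A B])
    have "qform D x = 0" if "v \<bullet> x = 0" for x
      using qform_add[of D ?B x] that by (simp add: D_def qform_hyperplane_restrict)
    then have "diag (Suc m) \<Lambda> (?B + D) = diag (Suc m) \<Lambda> ?B"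
      using null[OF D] by (intro diag_add_null[OF form]) simp
    then show ?thesis
      using A B by (simp add: \<Lambda>_def polar_form_diag[OF pol] symm_id D_def del: replicate_mset_Suc)
  qed
  then have "\<not> complete_garding g" by (rule not_complete_of_restriction_invariant[OF gd v])
  then show False using complete by simp
qed

lemma pos_def_polar_mat:
  fixes g :: "real^'n^'n \<Rightarrow> real"
  assumes N: "N \<ge> 1" and gd: "garding_dirichlet UNIV N g" and complete: "complete_garding g"
    and Gs: "length Gs = N - 1" "set Gs \<subseteq> garding_cone UNIV g"
  shows "pos_def (polar_mat N g Gs)"
proof -
  note pol = garding_dirichlet_polarization(1)[OF gd]
  have sym: "set Gs \<subseteq> sym_mats" using Gs(2) garding_cone_subset_sym_mats by blast
  obtain m where m: "N = Suc m" using N by (cases N) auto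
  have "qform (polar_mat N g Gs) v > 0" if "v \<noteq> 0" for v
  proof -
    define w where "w = (1 / norm v) *\<^sub>R v"
    have w: "norm w = 1" "v = norm v *\<^sub>R w" using that by (simp_all add: w_def)
    have "qform (polar_mat N g Gs) w = polarization N g (Gs @ [outer w])"
      using polar_mat(2)[OF pol N Gs(1) sym, of "outer w"] by (simp add: mat_inner_outer)
    also have "\<dots> = polar_form N g (add_mset (outer w) (mset Gs))"
      using polar_form_sym[OF pol, of "Gs @ [outer w]"] sym Gs(1) m by simp
    also have "\<dots> > 0"
      using polar_form_rank_one_pos[OF gd[unfolded m] complete w(1), of "mset Gs"] Gs m by simp
    finally have "(norm v)\<^sup>2 * qform (polar_mat N g Gs) w > 0"
      using that by simp
    then show ?thesis by (subst w(2)) (simp add: qform_smult)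
  qed
  then show ?thesis
    using polar_mat(1)[OF pol N Gs(1) sym] by (simp add: pos_def_def)
qed

lemma pos_def_sum:
  assumes "finite I" "I \<noteq> {}" "\<And>i. i \<in> I \<Longrightarrow> pos_def (M i)"
  shows "pos_def (\<Sum>i\<in>I. M i)"
  using assms
proof (induction I rule: finite_ne_induct)
  case (insert i I)
  then have "pos_def (M i)" "pos_def (\<Sum>i\<in>I. M i)" by auto
  then show ?case
    using insert(1,3) subspace_add[OF subspace_sym_mats]
    by (auto simp: pos_def_def qform_add intro!: add_pos_pos)
qed simp

lemma diff_eq_mat_inner_polar_mat_sum:
  fixes g :: "real^'n^'n \<Rightarrow> real"
  assumes pol: "is_polarization N g (polarization N g)" and N: "N \<ge> 1"
    and A: "A \<in> sym_mats" and B: "B \<in> sym_mats"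
  shows "g A - g B = mat_inner (polar_mat_sum N g A B) (A - B)"
proof -
  have AB: "A - B \<in> sym_mats" using subspace_diff[OF subspace_sym_mats A B] .
  have "mat_inner (polar_mat_k N g k A B) (A - B) =
      polarization N g (replicate k A @ replicate (N - 1 - k) B @ [A - B])" if "k \<in> {0..N - 1}" for k
    using polar_mat(2)[OF pol N _ _ AB, of "replicate k A @ replicate (N - 1 - k) B"] that A B N
    by (simp add: polar_mat_k_def set_replicate_conv_if)
  then have "(\<Sum>k = 0..N - 1. mat_inner (polar_mat_k N g k A B) (A - B)) = g A - g B"
    using polarization_telescope[OF pol N A B] by simp
  then show ?thesis
    by (simp add: polar_mat_sum_def mat_inner_eq_inner[OF AB] inner_sum_left)
qed

theorem theorem4p4:
  fixes g :: "real^'n^'n \<Rightarrow> real" and N :: nat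
  assumes "N \<ge> 1" and "garding_dirichlet UNIV N g"
  shows "(\<forall>A\<in>sym_mats. \<forall>B\<in>sym_mats. g A - g B = mat_inner (polar_mat_sum N g A B) (A - B)) \<and>
    (complete_garding g \<longrightarrow>
       (\<forall>A\<in>garding_cone UNIV g. \<forall>B\<in>garding_cone UNIV g. pos_def (polar_mat_sum N g A B))) \<and>
    (complete_garding g \<longrightarrow>
       (\<forall>Gs. length Gs = N - 1 \<and> set Gs \<subseteq> garding_cone UNIV g \<longrightarrow> pos_def (polar_mat N g Gs)))"
proof (intro conjI impI ballI allI)
  fix A B :: "real^'n^'n" assume "A \<in> sym_mats" "B \<in> sym_mats"
  then show "g A - g B = mat_inner (polar_mat_sum N g A B) (A - B)"
    using diff_eq_mat_inner_polar_mat_sum[OF garding_dirichlet_polarization(1)[OF assms(2)] assms(1)] by blast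
next
  fix A B assume complete: "complete_garding g"
    and AB: "A \<in> garding_cone UNIV g" "B \<in> garding_cone UNIV g"
  show "pos_def (polar_mat_sum N g A B)"
    unfolding polar_mat_sum_def polar_mat_k_def
  proof (rule pos_def_sum)
    fix k assume "k \<in> {0..N - 1}"
    then show "pos_def (polar_mat N g (replicate k A @ replicate (N - 1 - k) B))"
      using AB by (intro pos_def_polar_mat[OF assms complete]) (auto simp: set_replicate_conv_if)
  qed simp_all
next
  fix Gs assume "complete_garding g" "length Gs = N - 1 \<and> set Gs \<subseteq> garding_cone UNIV g"
  then show "pos_def (polar_mat N g Gs)" using pos_def_polar_mat[OF assms] by blast
qed

end
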